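(* Fix an integer $h\ge2$ and $D>0$ and write $\Phi_{\alpha,D,h}=\Phi_{\alpha,\alpha,D,h}$. (1) For $0<\alpha<1$, $\Phi_{\alpha,D,h}(C)\asymp C^{\theta_h(\alpha)}$ for all small $C>0$ (implied constants depending only on $\alpha,D,h$), where $\theta_h(\alpha)=\min\bigl\{\frac{1}{h\alpha},\frac{1-\alpha}{(h-1)\alpha}\bigr\}$, the two branches exchanging at $\alpha=1/h$. (2) $\lim_{C\downarrow0}\Phi_{1,D,h}(C)\log\frac1C=(h-1)D$. (3) For $\alpha>1$, $\lim_{C\downarrow0}\Phi_{\alpha,D,h}(C)=1-e^{-(\alpha-1)D/\alpha}>0$.
   Context: For an abelian group $G$ and $A\subset G$, $\mathcal U_h(A)$ is the set of multisets of size $h$ with elements in $A$, and $s(u)$ is the sum of $u$ counted with multiplicity. A set $B\subset G$ is a $B_h$ set if $s$ is injective on $\mathcal U_h(B)$. Let $X$ be a discrete $G$-valued random variable with countable support $A$, $X_1,\dots,X_h$ independent copies, $U_h=\{X_1,\dots,X_h\}$ (a random multiset) and $S_h=X_1+\dots+X_h$. For discrete $Y$ and $\alpha>0$, $\alpha\ne1$, $M_\alpha(Y)=\sum_y\mathbb P(Y=y)^\alpha$ and $H_\alpha(Y)=\frac{\log M_\alpha(Y)}{1-\alpha}$; $H_1=H$ is Shannon entropy; logarithms are natural. $\Delta_{\alpha,h}(X)=H_\alpha(U_h)-H_\alpha(S_h)$; $\delta_h(X)=1-\sup\{\mathbb P(X\in B):B\subset A\text{ is a }B_h\text{ set}\}$;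 $$\Phi_{\alpha,\beta,D,h}(C)=\sup_G\ \sup_{X\text{ on }G}\{\delta_h(X):\Delta_{\alpha,h}(X)\le C,\ H_\beta(X)\le D\},$$ with $G$ over all abelian groups and $X$ over those variables with $M_\alpha(U_h)<\infty$ if $\alpha\ne1$ and $H(X)<\infty$ if $\alpha=1$. *)

theory Defs
  imports
    "HOL-Probability.Probability"
    "HOL-Algebra.Generated_Groups"
    "HOL-Algebra.Weak_Morphisms"
    "HOL-Library.Infinite_Typeclass"
begin

text \<open>
  Abelian groups are multiplicative \<open>HOL-Algebra\<close> groups, so the sum \<open>s(u)\<close> of a
  multiset is written as a product.  A discrete \<open>G\<close>-valued random variable enters
  only through its law, a \<open>pmf\<close> \<open>X\<close> with \<open>set_pmf X \<subseteq> carrier G\<close>; its (automatically countable)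
  support is \<open>set_pmf X\<close>.
\<close>

definition msum :: "'g monoid \<Rightarrow> 'g multiset \<Rightarrow> 'g" where
  "msum G u = (\<Otimes>\<^bsub>G\<^esub> a \<in> set_mset u. a [^]\<^bsub>G\<^esub> count u a)"

definition Bh_set :: "'g monoid \<Rightarrow> nat \<Rightarrow> 'g set \<Rightarrow> bool" where
  "Bh_set G h B \<longleftrightarrow> B \<subseteq> carrier G \<and> inj_on (msum G) (multisets_of_size B h)"

text \<open>The laws of \<open>U\<^sub>h\<close> and \<open>S\<^sub>h\<close>; \<open>replicate_pmf h X\<close> is the law of \<open>h\<close> independent copies of \<open>X\<close>.\<close>

definition U_law :: "nat \<Rightarrow> 'g pmf \<Rightarrow> 'g multiset pmf" where
  "U_law h X = map_pmf mset (replicate_pmf h X)"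

definition S_law :: "'g monoid \<Rightarrow> nat \<Rightarrow> 'g pmf \<Rightarrow> 'g pmf" where
  "S_law G h X = map_pmf (\<lambda>xs. foldr (\<otimes>\<^bsub>G\<^esub>) xs \<one>\<^bsub>G\<^esub>) (replicate_pmf h X)"

text \<open>
  Power sums and entropies may be infinite (for \<open>\<alpha> \<le> 1\<close>), hence the extended values;
  \<open>infsum\<close> over all of the type always converges in \<open>ennreal\<close>, and points outside the support
  contribute \<open>0 powr \<alpha> = 0\<close> and \<open>- (0 * ln 0) = 0\<close>.
\<close>

definition power_sum :: "real \<Rightarrow> 'a pmf \<Rightarrow> ennreal" where
  "power_sum \<alpha> Y = (\<Sum>\<^sub>\<infinity>y. ennreal (pmf Y y powr \<alpha>))"

definition shannon_entropy :: "'a pmf \<Rightarrow> ennreal" where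
  "shannon_entropy Y = (\<Sum>\<^sub>\<infinity>y. ennreal (- (pmf Y y * ln (pmf Y y))))"

text \<open>For \<open>\<alpha> > 1\<close> the power sum is at most 1, so the value \<open>\<infinity>\<close> is only used for \<open>\<alpha> < 1\<close>.\<close>

definition renyi_entropy :: "real \<Rightarrow> 'a pmf \<Rightarrow> ereal" where
  "renyi_entropy \<alpha> Y =
     (if \<alpha> = 1 then enn2ereal (shannon_entropy Y)
      else if power_sum \<alpha> Y = \<infinity> then \<infinity>
      else ereal (ln (enn2real (power_sum \<alpha> Y)) / (1 - \<alpha>)))"

definition finite_entropy_cond :: "real \<Rightarrow> nat \<Rightarrow> 'g pmf \<Rightarrow> bool" where
  "finite_entropy_cond \<alpha> h X \<longleftrightarrow>
     (if \<alpha> = 1 then renyi_entropy 1 X < \<infinity> else power_sum \<alpha> (U_law h X) < \<infinity>)"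

text \<open>Under \<open>finite_entropy_cond \<alpha> h X\<close> both terms of the difference are finite.\<close>

definition entropy_gap :: "real \<Rightarrow> nat \<Rightarrow> 'g monoid \<Rightarrow> 'g pmf \<Rightarrow> ereal" where
  "entropy_gap \<alpha> h G X = renyi_entropy \<alpha> (U_law h X) - renyi_entropy \<alpha> (S_law G h X)"

definition Bh_defect :: "nat \<Rightarrow> 'g monoid \<Rightarrow> 'g pmf \<Rightarrow> real" where
  "Bh_defect h G X =
     1 - (SUP B \<in> {B. B \<subseteq> set_pmf X \<and> Bh_set G h B}. measure_pmf.prob X B)"

definition admissible :: "real \<Rightarrow> real \<Rightarrow> real \<Rightarrow> nat \<Rightarrow> real \<Rightarrow> 'g monoid \<Rightarrow> 'g pmf \<Rightarrow> bool" where
  "admissible \<alpha> \<beta> D h C G X \<longleftrightarrow>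
     comm_group G \<and> set_pmf X \<subseteq> carrier G \<and> finite_entropy_cond \<alpha> h X \<and>
     entropy_gap \<alpha> h G X \<le> ereal C \<and> renyi_entropy \<beta> X \<le> ereal D"

text \<open>
  HOL cannot quantify over all types inside a term, so the supremum runs over all abelian groups
  whose carrier is an arbitrary subset of an arbitrary infinite type \<open>'g\<close>.  Since \<open>X\<close> lives on
  the countable subgroup generated by its support, the value does not depend on \<open>'g\<close>
  (\<open>Phi_type_independent\<close> below), and groups on finite types add nothing (\<open>Bh_defect_le_Phi\<close>):
  it is the supremum over all abelian groups.
  For \<open>C, D \<ge> 0\<close> the supremum is over a nonempty subset of \<open>{0..1}\<close> (constant \<open>X\<close> are admissible).
\<close>

definition Phi :: "'g::infinite itself \<Rightarrow> real \<Rightarrow> real \<Rightarrow> real \<Rightarrow> nat \<Rightarrow> real \<Rightarrow> real" where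
  "Phi T \<alpha> \<beta> D h C =
     Sup {Bh_defect h G X | (G :: 'g monoid) X. admissible \<alpha> \<beta> D h C G X}"

definition theta :: "nat \<Rightarrow> real \<Rightarrow> real" where
  "theta h \<alpha> = min (1 / (real h * \<alpha>)) ((1 - \<alpha>) / ((real h - 1) * \<alpha>))"


subsection \<open>Sums of multisets and of samples agree\<close>

lemma msum_mset:
  assumes "comm_group G" "set xs \<subseteq> carrier G"
  shows "msum G (mset xs) = foldr (\<otimes>\<^bsub>G\<^esub>) xs \<one>\<^bsub>G\<^esub>"
  using assms(2)
proof (induction xs)
  case Nil
  interpret comm_group G by fact
  show ?case by (simp add: msum_def)
next
  case (Cons x xs)
  interpret comm_group G by fact
  let ?u = "mset xs"
  have x: "x \<in> carrier G" and xs: "set xs \<subseteq> carrier G" using Cons.prems by auto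
  let ?A = "insert x (set xs)"
  have ext: "msum G v = (\<Otimes>\<^bsub>G\<^esub> a \<in> ?A. a [^]\<^bsub>G\<^esub> count v a)" if "set_mset v \<subseteq> ?A" for v
    unfolding msum_def
    by (rule finprod_mono_neutral_cong_left) (use that x xs in \<open>auto simp: not_in_iff\<close>)
  have "msum G (mset (x # xs)) =
      (\<Otimes>\<^bsub>G\<^esub> a \<in> ?A. (if a = x then x else \<one>\<^bsub>G\<^esub>) \<otimes>\<^bsub>G\<^esub> a [^]\<^bsub>G\<^esub> count ?u a)"
  proof (subst ext)
    show "(\<Otimes>\<^bsub>G\<^esub> a \<in> ?A. a [^]\<^bsub>G\<^esub> count (mset (x # xs)) a) =
      (\<Otimes>\<^bsub>G\<^esub> a \<in> ?A. (if a = x then x else \<one>\<^bsub>G\<^esub>) \<otimes>\<^bsub>G\<^esub> a [^]\<^bsub>G\<^esub> count ?u a)"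
      by (rule finprod_cong')
        (use x xs in \<open>auto simp: subset_iff intro!: m_comm\<close>)
  qed auto
  also have "\<dots> = (\<Otimes>\<^bsub>G\<^esub> a \<in> ?A. if a = x then x else \<one>\<^bsub>G\<^esub>) \<otimes>\<^bsub>G\<^esub> msum G ?u"
    using x xs by (subst ext) (auto intro!: finprod_multf)
  also have "(\<Otimes>\<^bsub>G\<^esub> a \<in> ?A. if a = x then x else \<one>\<^bsub>G\<^esub>) = x"
    using finprod_singleton[of x ?A "\<lambda>_. x"] x by (simp add: eq_commute)
  finally show ?case using Cons.IH xs by simp
qed

lemma S_law_eq_msum_U_law:
  assumes "comm_group G" "set_pmf X \<subseteq> carrier G"
  shows "S_law G h X = map_pmf (msum G) (U_law h X)"
  unfolding S_law_def U_law_def pmf.map_comp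
  by (rule map_pmf_cong) (use assms msum_mset in \<open>fastforce simp: set_replicate_pmf\<close>)+


subsection \<open>Independence of the ambient type\<close>

lemma infsum_map_pmf_inj:
  fixes g :: "real \<Rightarrow> ennreal"
  assumes "inj_on f (set_pmf Y)" "g 0 = 0"
  shows "(\<Sum>\<^sub>\<infinity>z. g (pmf (map_pmf f Y) z)) = (\<Sum>\<^sub>\<infinity>y. g (pmf Y y))"
proof -
  have "(\<Sum>\<^sub>\<infinity>z. g (pmf (map_pmf f Y) z)) = (\<Sum>\<^sub>\<infinity>z\<in>f ` set_pmf Y. g (pmf (map_pmf f Y) z))"
    by (rule infsum_cong_neutral) (use assms in \<open>auto simp: pmf_map_outside\<close>)
  also have "\<dots> = (\<Sum>\<^sub>\<infinity>y\<in>set_pmf Y. g (pmf (map_pmf f Y) (f y)))"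
    using infsum_reindex[OF assms(1)] by (simp add: o_def)
  also have "\<dots> = (\<Sum>\<^sub>\<infinity>y\<in>set_pmf Y. g (pmf Y y))"
    by (rule infsum_cong) (use assms in \<open>simp add: pmf_map_inj\<close>)
  also have "\<dots> = (\<Sum>\<^sub>\<infinity>y. g (pmf Y y))"
    by (rule infsum_cong_neutral) (use assms in \<open>auto simp: set_pmf_iff\<close>)
  finally show ?thesis .
qed

lemma power_sum_map_inj:
  "inj_on f (set_pmf Y) \<Longrightarrow> power_sum \<alpha> (map_pmf f Y) = power_sum \<alpha> Y"
  unfolding power_sum_def by (rule infsum_map_pmf_inj) auto

lemma renyi_entropy_map_inj:
  assumes "inj_on f (set_pmf Y)"
  shows "renyi_entropy \<alpha> (map_pmf f Y) = renyi_entropy \<alpha> Y"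
  using power_sum_map_inj[OF assms]
    infsum_map_pmf_inj[OF assms, of "\<lambda>t. ennreal (- (t * ln t))"]
  unfolding renyi_entropy_def shannon_entropy_def by simp

lemma replicate_map_pmf: "replicate_pmf n (map_pmf f p) = map_pmf (map f) (replicate_pmf n p)"
  by (induction n) (simp_all add: map_bind_pmf bind_map_pmf)

lemma countable_generate:
  assumes "countable A"
  shows "countable (generate G A)"
proof -
  define step where
    "step B = insert \<one>\<^bsub>G\<^esub> (A \<union> m_inv G ` A) \<union> B \<union> (\<lambda>(x, y). x \<otimes>\<^bsub>G\<^esub> y) ` (B \<times> B)" for B
  define L where "L n = (step ^^ n) {}" for n
  have cnt: "countable (L n)" for n
    by (induction n) (auto simp: L_def step_def assms)
  have mono: "L m \<subseteq> L n" if "m \<le> n" for m n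
    using that by (induction rule: dec_induct) (auto simp: L_def step_def)
  have one: "insert \<one>\<^bsub>G\<^esub> (A \<union> m_inv G ` A) \<subseteq> L 1" by (auto simp: L_def step_def)
  have mult: "x \<otimes>\<^bsub>G\<^esub> y \<in> L (Suc n)" if "x \<in> L n" "y \<in> L n" for x y n
    using that by (auto simp: L_def step_def)
  have "x \<in> (\<Union>n. L n)" if "x \<in> generate G A" for x
    using that
  proof induction
    case (eng x y)
    then obtain m n where "x \<in> L m" "y \<in> L n" by auto
    then have "x \<in> L (max m n)" "y \<in> L (max m n)" using mono by (meson max.cobounded1 max.cobounded2 subsetD)+
    then show ?case using mult by blast
  qed (use one in blast)+
  then show ?thesis using cnt by (meson countable_UN countable_subset countableI_type subsetI)
qed

lemma countable_inj_infinite: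
  assumes "countable K"
  obtains f :: "'k \<Rightarrow> 'g::infinite" where "inj_on f K"
proof -
  obtain e :: "nat \<Rightarrow> 'g" where "inj e" using infinite_countable_subset[OF infinite_UNIV] by blast
  moreover have "inj_on (to_nat_on K) K" using assms by (rule inj_on_to_nat_on)
  ultimately have "inj_on (e \<circ> to_nat_on K) K" by (meson comp_inj_on inj_on_subset subset_UNIV)
  then show thesis by (rule that)
qed

lemma inj_on_image_mset:
  assumes "inj_on f K"
  shows "inj_on (image_mset f) {u. set_mset u \<subseteq> K}"
  by (rule inj_on_inverseI[where g = "image_mset (inv_into K f)"])
    (use assms in \<open>auto simp: multiset.map_comp o_def subset_iff intro!: multiset.map_ident_strong\<close>)

lemma transfer_admissible:
  fixes G :: "'k monoid"
  assumes adm: "admissible \<alpha> \<beta> D h C G X"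
  shows "\<exists>(G' :: 'g::infinite monoid) X'.
           admissible \<alpha> \<beta> D h C G' X' \<and> Bh_defect h G' X' = Bh_defect h G X"
proof -
  have cG: "comm_group G" and sub: "set_pmf X \<subseteq> carrier G"
    using adm by (auto simp: admissible_def)
  interpret G: comm_group G by (rule cG)
  define K where "K = generate G (set_pmf X)"
  have subK: "set_pmf X \<subseteq> K" by (auto simp: K_def generate.incl)
  have KG: "K \<subseteq> carrier G" unfolding K_def by (rule G.generate_incl[OF sub])
  have sgK: "subgroup K G" unfolding K_def by (rule G.generate_is_subgroup[OF sub])
  have cgK: "comm_group (G\<lparr>carrier := K\<rparr>)"
    using G.subgroup_imp_group[OF sgK] KG by (intro group.group_comm_groupI) (auto intro!: G.m_comm)
  obtain f :: "'k \<Rightarrow> 'g" where f: "inj_on f K"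
    using countable_inj_infinite countable_generate[of "set_pmf X" G] unfolding K_def by auto
  define G' where "G' = image_group f (G\<lparr>carrier := K\<rparr>)"
  have iso: "f \<in> iso (G\<lparr>carrier := K\<rparr>) G'"
    unfolding G'_def by (rule inj_imp_image_group_iso) (use f in simp)
  have carG': "carrier G' = f ` K" by (simp add: G'_def image_group_def)
  have oneG': "\<one>\<^bsub>G'\<^esub> = f \<one>\<^bsub>G\<^esub>" by (simp add: G'_def image_group_def)
  have multG': "f (x \<otimes>\<^bsub>G\<^esub> y) = f x \<otimes>\<^bsub>G'\<^esub> f y" if "x \<in> K" "y \<in> K" for x y
    using iso that by (auto simp: iso_def hom_def)
  have cG': "comm_group G'"
    using comm_group.iso_imp_img_comm_group[OF cgK iso] by (simp add: G'_def image_group_def)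
  have foldrK: "foldr (\<otimes>\<^bsub>G\<^esub>) xs \<one>\<^bsub>G\<^esub> \<in> K" if "set xs \<subseteq> K" for xs
    using that by (induction xs) (auto intro: subgroup.one_closed[OF sgK] subgroup.m_closed[OF sgK])
  have foldrf: "foldr (\<otimes>\<^bsub>G'\<^esub>) (map f xs) \<one>\<^bsub>G'\<^esub> = f (foldr (\<otimes>\<^bsub>G\<^esub>) xs \<one>\<^bsub>G\<^esub>)" if "set xs \<subseteq> K" for xs
    using that by (induction xs) (simp_all add: oneG' multG' foldrK)
  have msumf: "msum G' (image_mset f u) = f (msum G u)" and msumK: "msum G u \<in> K"
    if u: "set_mset u \<subseteq> K" for u
  proof -
    obtain xs where xs: "mset xs = u" using ex_mset by blast
    have set: "set xs \<subseteq> K" using xs u by auto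
    have 1: "msum G u = foldr (\<otimes>\<^bsub>G\<^esub>) xs \<one>\<^bsub>G\<^esub>"
      using msum_mset[OF cG, of xs] set KG xs by auto
    have "msum G' (mset (map f xs)) = foldr (\<otimes>\<^bsub>G'\<^esub>) (map f xs) \<one>\<^bsub>G'\<^esub>"
      by (rule msum_mset[OF cG']) (use set carG' in auto)
    then show "msum G' (image_mset f u) = f (msum G u)" using 1 foldrf[OF set] xs by simp
    show "msum G u \<in> K" using 1 foldrK[OF set] by simp
  qed
  define X' where "X' = map_pmf f X"
  have fX: "inj_on f (set_pmf X)" using f subK by (rule inj_on_subset)
  have U': "U_law h X' = map_pmf (image_mset f) (U_law h X)"
    by (simp add: U_law_def X'_def replicate_map_pmf pmf.map_comp o_def)
  have injU: "inj_on (image_mset f) (set_pmf (U_law h X))"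
    by (rule inj_on_subset[OF inj_on_image_mset[OF f]])
      (use subK in \<open>auto simp: U_law_def set_replicate_pmf\<close>)
  have S': "S_law G' h X' = map_pmf f (S_law G h X)"
    unfolding S_law_def X'_def replicate_map_pmf pmf.map_comp
    by (rule map_pmf_cong) (use foldrf subK in \<open>fastforce simp: set_replicate_pmf\<close>)+
  have injS: "inj_on f (set_pmf (S_law G h X))"
    by (rule inj_on_subset[OF f])
      (use subK foldrK in \<open>fastforce simp: S_law_def set_replicate_pmf\<close>)
  have adm': "admissible \<alpha> \<beta> D h C G' X'"
    using adm cG' sub subK carG' unfolding admissible_def finite_entropy_cond_def entropy_gap_def
      U' S' renyi_entropy_map_inj[OF injU] renyi_entropy_map_inj[OF injS] power_sum_map_inj[OF injU]
    by (auto simp: X'_def renyi_entropy_map_inj[OF fX])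
  have mof: "multisets_of_size (f ` B) h = image_mset f ` multisets_of_size B h" for B
  proof
    show "image_mset f ` multisets_of_size B h \<subseteq> multisets_of_size (f ` B) h"
      by (auto simp: multisets_of_size_def intro!: imageI)
    show "multisets_of_size (f ` B) h \<subseteq> image_mset f ` multisets_of_size B h"
    proof
      fix v assume v: "v \<in> multisets_of_size (f ` B) h"
      let ?u = "image_mset (inv_into B f) v"
      have "?u \<in> multisets_of_size B h"
        using v by (auto simp: multisets_of_size_def inv_into_into subset_iff)
      moreover have "image_mset f ?u = v"
        using v by (auto simp: multisets_of_size_def multiset.map_comp o_def f_inv_into_f subset_iff
            intro!: multiset.map_ident_strong)
      ultimately show "v \<in> image_mset f ` multisets_of_size B h" by (metis imageI)
    qed
  qed
  have Bh: "Bh_set G' h (f ` B) \<longleftrightarrow> Bh_set G h B" if B: "B \<subseteq> set_pmf X" for B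
  proof -
    let ?M = "multisets_of_size B h"
    have M: "set_mset u \<subseteq> K" if "u \<in> ?M" for u
      using that B subK by (auto simp: multisets_of_size_def)
    have "inj_on (image_mset f) ?M"
      by (rule inj_on_subset[OF inj_on_image_mset[OF f]]) (use M in auto)
    then have "inj_on (msum G') (image_mset f ` ?M) \<longleftrightarrow> inj_on (msum G' \<circ> image_mset f) ?M"
      using comp_inj_on_iff by blast
    also have "\<dots> \<longleftrightarrow> inj_on (f \<circ> msum G) ?M"
      by (rule inj_on_cong) (use M msumf in simp)
    also have "\<dots> \<longleftrightarrow> inj_on (msum G) ?M"
    proof
      show "inj_on (f \<circ> msum G) ?M \<Longrightarrow> inj_on (msum G) ?M" by (rule inj_on_imageI2)
      show "inj_on (msum G) ?M \<Longrightarrow> inj_on (f \<circ> msum G) ?M"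
        by (rule comp_inj_on) (auto intro!: inj_on_subset[OF f] M msumK)
    qed
    finally show ?thesis using B subK KG carG' by (auto simp: Bh_set_def mof)
  qed
  have prob: "measure_pmf.prob X' (f ` B) = measure_pmf.prob X B" if B: "B \<subseteq> set_pmf X" for B
  proof -
    have "measure_pmf.prob X (f -` f ` B) = measure_pmf.prob X B"
    proof (rule measure_pmf.finite_measure_eq_AE)
      show "AE x in measure_pmf X. (x \<in> f -` f ` B) = (x \<in> B)"
        using B fX by (auto simp: AE_measure_pmf_iff inj_on_image_mem_iff)
    qed auto
    then show ?thesis by (simp add: X'_def)
  qed
  have sets: "{B'. B' \<subseteq> set_pmf X' \<and> Bh_set G' h B'} = (`) f ` {B. B \<subseteq> set_pmf X \<and> Bh_set G h B}"
    using Bh by (auto simp: X'_def subset_image_iff)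
  have "Bh_defect h G' X' = Bh_defect h G X"
    unfolding Bh_defect_def sets image_image
    using prob by (intro arg_cong[of _ _ "\<lambda>t. 1 - t"] SUP_cong) auto
  with adm' show ?thesis by blast
qed

lemma Bh_defect_values_subset:
  "{Bh_defect h G X | (G :: 'k monoid) X. admissible \<alpha> \<beta> D h C G X}
     \<subseteq> {Bh_defect h G X | (G :: 'g::infinite monoid) X. admissible \<alpha> \<beta> D h C G X}"
proof clarify
  fix G :: "'k monoid" and X
  assume "admissible \<alpha> \<beta> D h C G X"
  from transfer_admissible[OF this, where 'g = 'g]
  show "\<exists>(G' :: 'g monoid) X'. Bh_defect h G X = Bh_defect h G' X' \<and> admissible \<alpha> \<beta> D h C G' X'"
    by metis
qed

lemma Phi_type_independent:
  "Phi TYPE('g::infinite) \<alpha> \<beta> D h C = Phi TYPE('k::infinite) \<alpha> \<beta> D h C"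
  unfolding Phi_def by (intro arg_cong[of _ _ Sup] equalityI Bh_defect_values_subset)

lemma Bh_defect_le_1: "Bh_defect h G X \<le> 1"
proof -
  have "Bh_set G h {}"
    by (auto simp: Bh_set_def multisets_of_size_def inj_on_def)
  then have "measure_pmf.prob X {} \<le> (SUP B \<in> {B. B \<subseteq> set_pmf X \<and> Bh_set G h B}. measure_pmf.prob X B)"
    by (intro cSUP_upper) (auto intro!: bdd_aboveI2[where M = 1])
  then show ?thesis by (simp add: Bh_defect_def)
qed

lemma Bh_defect_le_Phi:
  fixes G :: "'k monoid"
  assumes "admissible \<alpha> \<beta> D h C G X"
  shows "Bh_defect h G X \<le> Phi TYPE('g::infinite) \<alpha> \<beta> D h C"
  unfolding Phi_def
proof (rule cSup_upper)
  show "Bh_defect h G X \<in> {Bh_defect h G X | (G :: 'g monoid) X. admissible \<alpha> \<beta> D h C G X}"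
    using Bh_defect_values_subset assms by blast
  show "bdd_above {Bh_defect h G X | (G :: 'g monoid) X. admissible \<alpha> \<beta> D h C G X}"
    using Bh_defect_le_1 by (intro bdd_aboveI[where M = 1]) auto
qed

end

(*
For a multiset u let P(u) be its probability and w(u) the probability of the fibre of the sum map
through u.  Both power sums are averages over the law of U: of P^(alpha-1) for U and of
w^(alpha-1) for S (of -ln P and -ln w when alpha = 1), so the entropy gap collects one contribution
from each u, and those with w(u) >= 2 P(u) contribute at least a constant times P(u)^alpha.

Upper bounds: run through the atoms in order of decreasing probability and keep an atom whenever the
kept set remains B_h.  A rejected atom a lies on a collision of multisets made of a and of kept atoms
that are at least as probable.  From these collisions one extracts distinct multisets v_a with
P(v_a) >= p(a)^h and w(v_a) >= 2 P(v_a), hence a bound on the sum of p(a)^(h alpha) over the rejected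
atoms.  Interpolating with the bound on the sum of p(a)^alpha (with a tangent line of the
exponential when alpha = 1) bounds the rejected mass.

Lower bounds: in a power of Z/h put mass 1-d at 0 and spread d evenly over N generators.  Every
subset of the support with two elements fails to be B_h, yet only the multisets {x,...,x} collide.
*)

theory Submission
  imports Defs "HOL-Real_Asymp.Real_Asymp"
begin

subsection \<open>Sums over discrete laws\<close>

text \<open>The obstacle in the upper bounds is to make the multisets v_a distinct. A collision of a
  rejected atom \<open>a\<close> joins a multiset u_a containing \<open>a\<close> to another one
  u'_a, which may consist of kept atoms only and be shared by many rejected atoms. So u'_a is used
  only when u_a has more than half of its fibre, a position that at most one multiset of a fibre can
  hold.

  The shape of the spikes follows from the two constraints on atoms of mass m: N * m^\<alpha> is
  limited by the entropy and N * m^(h*\<alpha>) by the gap. For \<alpha> \<le> 1/h one light atom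
  already gives the right order; for 1/h < \<alpha> < 1 the entropy budget has to be filled, with N
  of order m^(-\<alpha>). For \<alpha> = 1, N is a power of 1/C, so that d * ln N, the main part of
  the entropy, is almost D. For \<alpha> > 1 an atom of mass exp (- (\<alpha> - 1) * D / \<alpha>)
  meets the entropy bound whatever the rest of the law is, so N may tend to infinity with C fixed;
  the defect therefore does not tend to 0.\<close>

lemma nn_integral_count_space_eq_infsum:
  fixes f :: "'a \<Rightarrow> ennreal"
  assumes "countable A"
  shows "(\<integral>\<^sup>+x. f x \<partial>count_space A) = infsum f A"
proof (cases "finite A")
  case True
  then show ?thesis by (simp add: nn_integral_count_space_finite)
next
  case False
  have bij: "bij_betw (from_nat_into A) UNIV A"
    using assms False by (rule bij_betw_from_nat_into)
  have "(f \<circ> from_nat_into A has_sum infsum (f \<circ> from_nat_into A) UNIV) UNIV"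
    by (intro has_sum_infsum nonneg_summable_on_complete) simp
  then have "(\<Sum>n. f (from_nat_into A n)) = infsum (f \<circ> from_nat_into A) UNIV"
    by (auto dest!: has_sum_imp_sums sums_unique simp: o_def)
  then show ?thesis
    using nn_integral_bij_count_space[OF bij, of f] infsum_reindex_bij_betw[OF bij, of f]
    by (simp add: nn_integral_count_space_nat o_def)
qed

text \<open>Turns a sum over values into an expectation. Expectations transport along
  \<open>map_pmf\<close>, so the quantities of U and S become integrals over the same law, that of
  U, and can be compared pointwise.\<close>

lemma infsum_pmf_eq_nn_integral:
  assumes "\<And>x. 0 < x \<Longrightarrow> x \<le> 1 \<Longrightarrow> g x = ennreal x * \<phi> x" "g 0 = 0"
  shows "(\<Sum>\<^sub>\<infinity>y. g (pmf Y y)) = (\<integral>\<^sup>+y. \<phi> (pmf Y y) \<partial>Y)"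
proof -
  have "(\<Sum>\<^sub>\<infinity>y. g (pmf Y y)) = (\<Sum>\<^sub>\<infinity>y\<in>set_pmf Y. g (pmf Y y))"
    by (rule infsum_cong_neutral) (use assms in \<open>auto simp: set_pmf_iff\<close>)
  also have "\<dots> = (\<integral>\<^sup>+y. g (pmf Y y) \<partial>count_space (set_pmf Y))"
    by (simp add: nn_integral_count_space_eq_infsum)
  also have "\<dots> = (\<integral>\<^sup>+y. pmf Y y * \<phi> (pmf Y y) \<partial>count_space (set_pmf Y))"
    by (rule nn_integral_cong) (use assms in \<open>simp add: pmf_positive pmf_le_1\<close>)
  also have "\<dots> = (\<integral>\<^sup>+y. pmf Y y * \<phi> (pmf Y y) \<partial>count_space UNIV)"
    by (subst nn_integral_count_space_indicator, simp)
      (auto intro!: nn_integral_cong simp: set_pmf_iff split: split_indicator)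
  also have "\<dots> = (\<integral>\<^sup>+y. \<phi> (pmf Y y) \<partial>Y)"
    by (simp add: nn_integral_measure_pmf)
  finally show ?thesis .
qed

lemma power_sum_eq_nn_integral:
  "power_sum \<alpha> Y = (\<integral>\<^sup>+y. ennreal (pmf Y y powr (\<alpha> - 1)) \<partial>Y)"
  unfolding power_sum_def
  by (rule infsum_pmf_eq_nn_integral)
    (simp_all add: ennreal_mult[symmetric] powr_diff)

lemma shannon_entropy_eq_nn_integral:
  "shannon_entropy Y = (\<integral>\<^sup>+y. ennreal (- ln (pmf Y y)) \<partial>Y)"
  unfolding shannon_entropy_def
  by (rule infsum_pmf_eq_nn_integral)
    (simp_all add: ennreal_mult[symmetric])

lemma sum_pmf_le_power_sum:
  assumes "finite F"
  shows "ennreal (\<Sum>a\<in>F. pmf X a powr \<alpha>) \<le> power_sum \<alpha> X"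
proof -
  have "ennreal (\<Sum>a\<in>F. pmf X a powr \<alpha>) = (\<Sum>a\<in>F. ennreal (pmf X a powr \<alpha>))"
    by simp
  also have "\<dots> \<le> power_sum \<alpha> X" unfolding power_sum_def
    by (subst nonneg_infsum_complete) (use assms in \<open>auto intro: SUP_upper\<close>)
  finally show ?thesis .
qed

lemma sum_pmf_le_shannon_entropy:
  assumes "finite F"
  shows "ennreal (\<Sum>a\<in>F. - (pmf X a * ln (pmf X a))) \<le> shannon_entropy X"
proof -
  have nn: "0 \<le> - (pmf X a * ln (pmf X a))" for a
    by (cases "pmf X a = 0") (auto simp: mult_le_0_iff pmf_le_1 pmf_nonneg less_le)
  have "ennreal (\<Sum>a\<in>F. - (pmf X a * ln (pmf X a))) = (\<Sum>a\<in>F. ennreal (- (pmf X a * ln (pmf X a))))"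
    by (rule sum_ennreal[symmetric]) (rule nn)
  also have "\<dots> \<le> shannon_entropy X" unfolding shannon_entropy_def
    by (subst nonneg_infsum_complete) (use assms in \<open>auto intro: SUP_upper\<close>)
  finally show ?thesis .
qed

text \<open>Rejected atoms are always estimated on finite subsets, which avoids summability
  questions; this passes to the whole, possibly infinite, set.\<close>

lemma pmf_prob_le_finite_sums:
  assumes "\<And>F. finite F \<Longrightarrow> F \<subseteq> A \<Longrightarrow> sum (pmf X) F \<le> b"
  shows "measure_pmf.prob X A \<le> b"
proof -
  have "pmf X summable_on A"
    using pmf_abs_summable[of X A] by (simp add: abs_summable_equivalent[symmetric] abs_summable_summable)
  moreover have "measure_pmf.prob X A = infsum (pmf X) A"
    by (simp add: measure_pmf_conv_infsetsum infsetsum_infsum pmf_abs_summable)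
  ultimately show ?thesis using assms by (auto intro: infsum_le_finite_sums)
qed

text \<open>The gain is a summand on the left because subtraction in \<open>ennreal\<close> is
  truncated and the integrals may still be infinite. Off \<open>V\<close> only the sign of
  \<open>g u - f u\<close> matters.\<close>

lemma sum_le_nn_integral_diff:
  fixes f g :: "'a \<Rightarrow> real"
  assumes "finite V" and f: "\<And>u. u \<in> set_pmf U \<Longrightarrow> 0 \<le> f u" and fg: "\<And>u. u \<in> set_pmf U \<Longrightarrow> f u \<le> g u"
    and V: "V \<subseteq> set_pmf U"
  shows "(\<integral>\<^sup>+u. ennreal (f u) \<partial>U) + ennreal (\<Sum>u\<in>V. pmf U u * (g u - f u)) \<le> (\<integral>\<^sup>+u. ennreal (g u) \<partial>U)"
proof -
  have "ennreal (\<Sum>u\<in>V. pmf U u * (g u - f u)) = (\<Sum>u\<in>V. ennreal (pmf U u * (g u - f u)))"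
    by (rule sum_ennreal[symmetric]) (use fg V in auto)
  also have "\<dots> = (\<Sum>u\<in>V. (ennreal (g u - f u) * indicator V u) * pmf U u)"
    by (rule sum.cong) (use fg V in \<open>auto simp: ennreal_mult mult.commute\<close>)
  also have "\<dots> = (\<integral>\<^sup>+u. ennreal (g u - f u) * indicator V u \<partial>U)"
    by (rule nn_integral_measure_pmf_support[symmetric]) (use assms in auto)
  finally have "(\<integral>\<^sup>+u. ennreal (f u) \<partial>U) + ennreal (\<Sum>u\<in>V. pmf U u * (g u - f u)) =
     (\<integral>\<^sup>+u. ennreal (f u) + ennreal (g u - f u) * indicator V u \<partial>U)"
    by (simp add: nn_integral_add)
  also have "\<dots> \<le> (\<integral>\<^sup>+u. ennreal (g u) \<partial>U)"
    by (rule nn_integral_mono_AE)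
      (use f fg in \<open>auto simp: AE_measure_pmf_iff ennreal_plus[symmetric] simp del: ennreal_plus
          split: split_indicator intro!: ennreal_leI\<close>)
  finally show ?thesis .
qed

subsection \<open>Greedy selection of a \<open>B\<^sub>h\<close> set\<close>

lemma finite_pmf_ge:
  assumes "0 < t"
  shows "finite {a. t \<le> pmf X a}"
proof (rule ccontr)
  assume inf: "infinite {a. t \<le> pmf X a}"
  obtain n :: nat where n: "1 < real n * t" using reals_Archimedean3[OF assms] by auto
  obtain F where F: "finite F" "card F = n" "F \<subseteq> {a. t \<le> pmf X a}"
    using infinite_arbitrarily_large[OF inf, of n] by blast
  have "real n * t \<le> sum (pmf X) F"
    using F sum_bounded_below[of F t "pmf X"] by auto
  also have "\<dots> = measure_pmf.prob X F" using F by (simp add: measure_measure_pmf_finite)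
  also have "\<dots> \<le> 1" by simp
  finally show False using n by simp
qed

text \<open>Only finitely many atoms reach a given positive probability, so every atom has finitely
  many predecessors and their number is a rank in \<open>nat\<close>. Ties are broken by an
  enumeration \<open>i\<close> of the countable support.\<close>

lemma pmf_decreasing_rank:
  "\<exists>r :: 'a \<Rightarrow> nat. inj_on r (set_pmf X) \<and>
     (\<forall>a\<in>set_pmf X. \<forall>b\<in>set_pmf X. r a \<le> r b \<longrightarrow> pmf X b \<le> pmf X a)"
proof -
  define i where "i = to_nat_on (set_pmf X)"
  have i: "inj_on i (set_pmf X)" unfolding i_def by (rule inj_on_to_nat_on) simp
  define L where "L a = {b \<in> set_pmf X. pmf X a < pmf X b \<or> pmf X b = pmf X a \<and> i b < i a}" for a
  have fin: "finite (L a)" if "a \<in> set_pmf X" for a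
    by (rule finite_subset[OF _ finite_pmf_ge[of "pmf X a" X]]) (use that pmf_positive in \<open>auto simp: L_def\<close>)
  have less: "card (L a) < card (L b)" if "a \<in> set_pmf X" "b \<in> set_pmf X"
    "pmf X b < pmf X a \<or> pmf X a = pmf X b \<and> i a < i b" for a b
  proof (rule psubset_card_mono[OF fin])
    have "L a \<subseteq> L b" "a \<in> L b" "a \<notin> L a" using that by (auto simp: L_def)
    then show "L a \<subset> L b" by blast
  qed fact
  show ?thesis
  proof (intro exI[of _ "\<lambda>a. card (L a)"] conjI ballI impI)
    show "inj_on (\<lambda>a. card (L a)) (set_pmf X)"
    proof (rule inj_onI)
      fix a b assume *: "a \<in> set_pmf X" "b \<in> set_pmf X" "card (L a) = card (L b)"
      then have "pmf X a = pmf X b" "i a = i b" using less[of a b] less[of b a] by force+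
      then show "a = b" using i * by (auto dest: inj_onD)
    qed
    show "pmf X b \<le> pmf X a" if "a \<in> set_pmf X" "b \<in> set_pmf X" "card (L a) \<le> card (L b)" for a b
      using less[of b a] that by force
  qed
qed

lemma Bh_set_empty: "0 < h \<Longrightarrow> Bh_set G h {}"
  by (auto simp: Bh_set_def)

text \<open>Stage \<open>n\<close> decides the at most one element of rank \<open>n\<close>, looking
  only at kept elements of smaller rank. The union of the stages is still a \<open>B\<^sub>h\<close>
  set because a violation involves only two finite multisets.\<close>

lemma greedy_Bh_set:
  fixes r :: "'g \<Rightarrow> nat"
  assumes A: "A \<subseteq> carrier G" and r: "inj_on r A" and h: "0 < h"
  shows "\<exists>B\<subseteq>A. Bh_set G h B \<and> (\<forall>a\<in>A - B. \<not> Bh_set G h (insert a {b \<in> B. r b < r a}))"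
proof -
  define step where "step n B = (let N = B \<union> {a \<in> A. r a = n} in if Bh_set G h N then N else B)" for n B
  define Bn where "Bn = rec_nat {} step"
  have Bn0: "Bn 0 = {}" and BnS: "Bn (Suc n) = step n (Bn n)" for n by (auto simp: Bn_def)
  have sub: "Bn n \<subseteq> {a \<in> A. r a < n}" for n
    by (induction n) (auto simp: Bn0 BnS step_def Let_def less_Suc_eq)
  have Bh: "Bh_set G h (Bn n)" for n
    by (induction n) (auto simp: Bn0 BnS step_def Let_def Bh_set_empty h)
  have mono: "Bn m \<subseteq> Bn n" if "m \<le> n" for m n
    using that by (induction rule: dec_induct) (auto simp: BnS step_def Let_def)
  \<comment> \<open>From stage \<open>n\<close> on only elements of rank at least \<open>n\<close>
    are added, so a stage is recovered from the union by truncating the ranks.\<close>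
  have eq: "{b \<in> \<Union>(range Bn). r b < n} = Bn n" for n
  proof (intro equalityI subsetI)
    fix b assume "b \<in> {b \<in> \<Union>(range Bn). r b < n}"
    then obtain m where b: "b \<in> Bn m" "r b < n" by auto
    have "b \<in> Bn n" if "b \<in> Bn m" "n \<le> m" for m
      using that(2,1)
    proof (induction rule: dec_induct)
      case (step k)
      then show ?case using b(2) by (auto simp: BnS step_def Let_def split: if_splits)
    qed
    then show "b \<in> Bn n" using b mono[of m n] by (cases "n \<le> m") auto
  next
    fix b assume "b \<in> Bn n"
    then show "b \<in> {b \<in> \<Union>(range Bn). r b < n}" using sub[of n] by auto
  qed
  show ?thesis
  proof (intro exI[of _ "\<Union>(range Bn)"] conjI ballI)
    show "\<Union>(range Bn) \<subseteq> A" using sub by blast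
    show "Bh_set G h (\<Union>(range Bn))"
      unfolding Bh_set_def
    proof (intro conjI inj_onI)
      show "\<Union>(range Bn) \<subseteq> carrier G" using sub A by blast
      fix u v assume uv: "u \<in> multisets_of_size (\<Union>(range Bn)) h" "v \<in> multisets_of_size (\<Union>(range Bn)) h"
        "msum G u = msum G v"
      \<comment> \<open>A bound above all ranks that occur in the two multisets, which therefore
        both live in stage \<open>n\<close>. The inserted \<open>0\<close> keeps the set under
        \<open>Max\<close> nonempty.\<close>
      define n where "n = Suc (Max (insert 0 (r ` (set_mset u \<union> set_mset v))))"
      have "r b < n" if "b \<in># u \<or> b \<in># v" for b
        using that unfolding n_def less_Suc_eq_le by (intro Max_ge) auto
      then have "set_mset u \<subseteq> {b \<in> \<Union>(range Bn). r b < n}" "set_mset v \<subseteq> {b \<in> \<Union>(range Bn). r b < n}"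
        using uv by (auto simp: multisets_of_size_def)
      then have "u \<in> multisets_of_size (Bn n) h" "v \<in> multisets_of_size (Bn n) h"
        using uv unfolding eq by (simp_all add: multisets_of_size_def)
      then show "u = v" using Bh[of n] uv(3) by (auto simp: Bh_set_def dest: inj_onD)
    qed
    fix a assume a: "a \<in> A - \<Union>(range Bn)"
    have "{x \<in> A. r x = r a} = {a}" using a r by (auto dest: inj_onD)
    then have "Bn (Suc (r a)) = (if Bh_set G h (insert a (Bn (r a))) then insert a (Bn (r a)) else Bn (r a))"
      by (simp add: BnS step_def)
    then show "\<not> Bh_set G h (insert a {b \<in> \<Union>(range Bn). r b < r a})"
      unfolding eq using a by (auto split: if_splits)
  qed
qed

section \<open>Probabilities of random multisets and collisions of rejected atoms\<close>

lemma pmf_replicate_pmf: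
  "pmf (replicate_pmf n X) xs = (if length xs = n then prod_list (map (pmf X) xs) else 0)"
proof (induction n arbitrary: xs)
  case 0
  then show ?case by simp
next
  case (Suc n)
  have eq: "replicate_pmf (Suc n) X = map_pmf (\<lambda>(x, xs). x # xs) (pair_pmf X (replicate_pmf n X))"
    by (simp add: pair_pmf_def map_bind_pmf bind_return_pmf)
  have inj: "inj_on (\<lambda>(x, xs). x # xs) S" for S :: "('a \<times> 'a list) set" by (auto simp: inj_on_def)
  show ?case
  proof (cases xs)
    case Nil
    then show ?thesis unfolding eq by (auto intro!: pmf_map_outside)
  next
    case (Cons y ys)
    have "pmf (replicate_pmf (Suc n) X) xs = pmf (pair_pmf X (replicate_pmf n X)) (y, ys)"
      unfolding eq Cons using pmf_map_inj'[OF inj, of "pair_pmf X (replicate_pmf n X)" "(y, ys)"] by simp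
    then show ?thesis using Suc.IH Cons by (simp add: pmf_pair)
  qed
qed

lemma set_pmf_U_law: "set_pmf (U_law h X) = multisets_of_size (set_pmf X) h"
proof (intro equalityI subsetI)
  fix u assume "u \<in> multisets_of_size (set_pmf X) h"
  moreover obtain xs where xs: "mset xs = u" using ex_mset by blast
  ultimately have "xs \<in> set_pmf (replicate_pmf h X)"
    by (auto simp: set_replicate_pmf multisets_of_size_def)
  then show "u \<in> set_pmf (U_law h X)" using xs by (auto simp: U_law_def)
qed (auto simp: U_law_def set_replicate_pmf multisets_of_size_def)

lemma pmf_replicate_le_pmf_U_law:
  "pmf (replicate_pmf h X) xs \<le> pmf (U_law h X) (mset xs)"
proof -
  have "pmf (replicate_pmf h X) xs = measure_pmf.prob (replicate_pmf h X) {xs}" by (simp add: measure_pmf_single)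
  also have "\<dots> \<le> pmf (U_law h X) (mset xs)"
    unfolding U_law_def pmf_map by (rule measure_pmf.finite_measure_mono) auto
  finally show ?thesis .
qed

text \<open>A single ordering of \<open>u\<close> already has at least this probability.\<close>

lemma pmf_U_law_ge_power:
  assumes "size u = h" "\<And>x. x \<in># u \<Longrightarrow> t \<le> pmf X x" "0 \<le> t"
  shows "t ^ h \<le> pmf (U_law h X) u"
proof -
  obtain xs where xs: "mset xs = u" using ex_mset by blast
  have "t ^ length ys \<le> prod_list (map (pmf X) ys)" if "set ys \<subseteq> set_mset u" for ys
    using that by (induction ys) (auto intro!: mult_mono assms zero_le_power)
  moreover have "length xs = h" "set xs \<subseteq> set_mset u" using xs assms(1) by auto
  ultimately have "t ^ h \<le> pmf (replicate_pmf h X) xs"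
    unfolding pmf_replicate_pmf by metis
  also have "\<dots> \<le> pmf (U_law h X) u" using pmf_replicate_le_pmf_U_law[of h X xs] xs by simp
  finally show ?thesis .
qed

lemma sum_pmf_le_pmf_map:
  assumes "finite F" "f ` F \<subseteq> {y}"
  shows "sum (pmf U) F \<le> pmf (map_pmf f U) y"
proof -
  have "sum (pmf U) F = measure_pmf.prob U F" using assms by (simp add: measure_measure_pmf_finite)
  also have "\<dots> \<le> pmf (map_pmf f U) y"
    unfolding pmf_map by (rule measure_pmf.finite_measure_mono) (use assms in auto)
  finally show ?thesis .
qed

text \<open>Of two distinct multisets in one fibre, the less probable one has at most half of the
  mass of the fibre; this is the factor 2. Atoms are treated in decreasing order of probability, so
  every member of a collision of \<open>a\<close> is at least as probable as \<open>a\<close>, which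
  gives the power \<open>pmf X a ^ h\<close>.\<close>

lemma collision_injection:
  fixes G :: "'g monoid"
  assumes X: "set_pmf X \<subseteq> carrier G" and h: "0 < h"
  shows "\<exists>B v. B \<subseteq> set_pmf X \<and> Bh_set G h B \<and> inj_on v (set_pmf X - B) \<and>
    (\<forall>a\<in>set_pmf X - B. v a \<in> set_pmf (U_law h X) \<and> pmf X a ^ h \<le> pmf (U_law h X) (v a) \<and>
       2 * pmf (U_law h X) (v a) \<le> pmf (map_pmf (msum G) (U_law h X)) (msum G (v a)))"
proof -
  let ?U = "U_law h X"
  define w where "w u = pmf (map_pmf (msum G) ?U) (msum G u)" for u
  obtain r :: "'g \<Rightarrow> nat" where r: "inj_on r (set_pmf X)"
    "\<And>a b. a \<in> set_pmf X \<Longrightarrow> b \<in> set_pmf X \<Longrightarrow> r a \<le> r b \<Longrightarrow> pmf X b \<le> pmf X a"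
    using pmf_decreasing_rank[of X] by blast
  obtain B where B: "B \<subseteq> set_pmf X" "Bh_set G h B"
    "\<And>a. a \<in> set_pmf X - B \<Longrightarrow> \<not> Bh_set G h (insert a {b \<in> B. r b < r a})"
    using greedy_Bh_set[OF X r(1) h] by metis
  define T where "T a = insert a {b \<in> B. r b < r a}" for a
  have T: "T a \<subseteq> set_pmf X" "\<And>x. x \<in> T a \<Longrightarrow> pmf X a \<le> pmf X x" if "a \<in> set_pmf X - B" for a
    using that B(1) r(2)[of _ a] by (auto simp: T_def)
  have ex: "\<exists>u u'. u \<in> multisets_of_size (T a) h \<and> u' \<in> multisets_of_size (T a) h \<and> u \<noteq> u' \<and>
      msum G u = msum G u' \<and> a \<in># u" if a: "a \<in> set_pmf X - B" for a
  proof -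
    have "\<not> inj_on (msum G) (multisets_of_size (T a) h)"
      using B(3)[OF a] T(1)[OF a] X by (auto simp: Bh_set_def T_def)
    then obtain u u' where u: "u \<in> multisets_of_size (T a) h" "u' \<in> multisets_of_size (T a) h" "u \<noteq> u'"
      "msum G u = msum G u'"
      by (auto simp: inj_on_def)
    \<comment> \<open>The kept atoms alone have no collision, so one of the two multisets contains
      \<open>a\<close>; after renaming it is \<open>u\<close>.\<close>
    have "a \<in># u \<or> a \<in># u'"
    proof (rule ccontr)
      assume "\<not> ?thesis"
      then have "u \<in> multisets_of_size B h" "u' \<in> multisets_of_size B h"
        using u by (auto simp: multisets_of_size_def T_def subset_iff)
      then show False using B(2) u(3,4) by (auto simp: Bh_set_def dest: inj_onD)
    qed
    then show ?thesis using u by metis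
  qed
  then obtain u u' where u: "\<And>a. a \<in> set_pmf X - B \<Longrightarrow> u a \<in> multisets_of_size (T a) h"
    and u': "\<And>a. a \<in> set_pmf X - B \<Longrightarrow> u' a \<in> multisets_of_size (T a) h"
    and ne: "\<And>a. a \<in> set_pmf X - B \<Longrightarrow> u a \<noteq> u' a"
    and eq: "\<And>a. a \<in> set_pmf X - B \<Longrightarrow> msum G (u a) = msum G (u' a)"
    and mem: "\<And>a. a \<in> set_pmf X - B \<Longrightarrow> a \<in># u a"
    by metis
  have pair: "pmf ?U x + pmf ?U y \<le> w x" if "x \<noteq> y" "msum G x = msum G y" for x y
    using sum_pmf_le_pmf_map[of "{x, y}" "msum G" "msum G x" ?U] that by (simp add: w_def)
  \<comment> \<open>a fibre has at most one element with more than half of its mass, so \<open>v\<close> is injective\<close>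
  define v where "v a = (if 2 * pmf ?U (u a) \<le> w (u a) then u a else u' a)" for a
  have v: "v a \<in> multisets_of_size (T a) h" if "a \<in> set_pmf X - B" for a
    using u[OF that] u'[OF that] by (simp add: v_def)
  \<comment> \<open>All members of \<open>T a\<close> other than \<open>a\<close> lie in
    \<open>B\<close>, so a rejected atom can be read off from any of its own multisets in which it
    occurs.\<close>
  have only: "x = a" if "a \<in> set_pmf X - B" "x \<notin> B" "x \<in># v a \<or> x \<in># u a" for a x
    using that v[of a] u[of a] by (auto simp: multisets_of_size_def T_def)
  show ?thesis
  proof (intro exI[of _ B] exI[of _ v] conjI ballI)
    show "v a \<in> set_pmf ?U" if "a \<in> set_pmf X - B" for a
      using v[OF that] T(1)[OF that] by (auto simp: set_pmf_U_law multisets_of_size_def)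
    show "pmf X a ^ h \<le> pmf ?U (v a)" if "a \<in> set_pmf X - B" for a
      by (rule pmf_U_law_ge_power) (use v[OF that] T(2)[OF that] in \<open>auto simp: multisets_of_size_def\<close>)
    show "2 * pmf ?U (v a) \<le> pmf (map_pmf (msum G) ?U) (msum G (v a))" if "a \<in> set_pmf X - B" for a
      using pair[OF ne[OF that] eq[OF that]] eq[OF that] by (auto simp: v_def w_def)
    show "B \<subseteq> set_pmf X" "Bh_set G h B" by (fact B)+
    show "inj_on v (set_pmf X - B)"
    proof (rule inj_onI)
      fix a b assume a: "a \<in> set_pmf X - B" and b: "b \<in> set_pmf X - B" and ab: "v a = v b"
      show "a = b"
      proof (cases "v a = u a \<or> v b = u b")
        case True
        then show ?thesis using only[of a b] only[of b a] mem a b ab by (metis DiffD2)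
      next
        \<comment> \<open>Both values are the partners \<open>u'\<close>, so \<open>u a\<close> and
          \<open>u b\<close> lie in the same fibre and each has more than half of it. They must
          coincide, and then \<open>a\<close> occurs in \<open>u b\<close>.\<close>
        case False
        then have big: "\<not> 2 * pmf ?U (u a) \<le> w (u a)" "\<not> 2 * pmf ?U (u b) \<le> w (u b)"
          and "u' a = u' b" using ab by (auto simp: v_def split: if_splits)
        then have s: "msum G (u a) = msum G (u b)" using eq a b by metis
        then have "u a = u b" using pair[of "u a" "u b"] big by (fastforce simp: w_def)
        then show ?thesis using only[of b a] mem a b by (metis DiffD2)
      qed
    qed
  qed
qed

text \<open>A multiset is at least as probable as each of its orderings and x^(\<alpha> - 1) does
  not increase with x; for ordered samples the power sum is multiplicative. This gives an absolute
  bound for U in terms of the entropy of \<open>X\<close>.\<close>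

lemma power_sum_U_law_le:
  assumes "\<alpha> \<le> 1"
  shows "power_sum \<alpha> (U_law h X) \<le> power_sum \<alpha> X ^ h"
proof -
  have "power_sum \<alpha> (U_law h X) =
      (\<integral>\<^sup>+xs. ennreal (pmf (U_law h X) (mset xs) powr (\<alpha> - 1)) \<partial>replicate_pmf h X)"
    by (simp add: power_sum_eq_nn_integral U_law_def nn_integral_map_pmf)
  also have "\<dots> \<le> (\<integral>\<^sup>+xs. ennreal (pmf (replicate_pmf h X) xs powr (\<alpha> - 1)) \<partial>replicate_pmf h X)"
    by (rule nn_integral_mono_AE)
      (use assms in \<open>auto simp: AE_measure_pmf_iff intro!: ennreal_leI powr_mono2' pmf_replicate_le_pmf_U_law pmf_positive\<close>)
  also have "\<dots> = power_sum \<alpha> X ^ h"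
  proof (induction h)
    case 0
    show ?case by (simp add: nn_integral_return)
  next
    case (Suc h)
    have "(\<integral>\<^sup>+xs. ennreal (pmf (replicate_pmf (Suc h) X) xs powr (\<alpha> - 1)) \<partial>replicate_pmf (Suc h) X)
      = (\<integral>\<^sup>+x. \<integral>\<^sup>+xs. ennreal (pmf (replicate_pmf (Suc h) X) (x # xs) powr (\<alpha> - 1)) \<partial>replicate_pmf h X \<partial>X)"
      by (simp del: pmf_replicate_pmf)
    also have "\<dots> = (\<integral>\<^sup>+x. \<integral>\<^sup>+xs. ennreal (pmf X x powr (\<alpha> - 1)) *
        ennreal (pmf (replicate_pmf h X) xs powr (\<alpha> - 1)) \<partial>replicate_pmf h X \<partial>X)"
      by (intro nn_integral_cong_AE AE_pmfI)
        (auto simp: pmf_replicate_pmf powr_mult set_replicate_pmf ennreal_mult' prod_list_nonneg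
          simp del: replicate_pmf.simps)
    also have "\<dots> = power_sum \<alpha> X ^ Suc h"
      by (simp add: nn_integral_cmult nn_integral_multc Suc.IH power_sum_eq_nn_integral)
    finally show ?case .
  qed
  finally show ?thesis .
qed

section \<open>From collisions to lower bounds for the entropy gap\<close>

lemma sum_le_nn_integral_diff_inj:
  fixes f g :: "'a \<Rightarrow> real"
  assumes "finite F" "inj_on v F" "\<And>u. u \<in> set_pmf U \<Longrightarrow> 0 \<le> f u" "\<And>u. u \<in> set_pmf U \<Longrightarrow> f u \<le> g u"
    and "\<And>a. a \<in> F \<Longrightarrow> v a \<in> set_pmf U" and "\<And>a. a \<in> F \<Longrightarrow> c a \<le> pmf U (v a) * (g (v a) - f (v a))"
  shows "(\<integral>\<^sup>+u. ennreal (f u) \<partial>U) + ennreal (\<Sum>a\<in>F. c a) \<le> (\<integral>\<^sup>+u. ennreal (g u) \<partial>U)"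
proof -
  have "(\<Sum>a\<in>F. c a) \<le> (\<Sum>u\<in>v ` F. pmf U u * (g u - f u))"
    using assms by (auto simp: sum.reindex intro: sum_mono)
  then have "(\<integral>\<^sup>+u. ennreal (f u) \<partial>U) + ennreal (\<Sum>a\<in>F. c a) \<le>
      (\<integral>\<^sup>+u. ennreal (f u) \<partial>U) + ennreal (\<Sum>u\<in>v ` F. pmf U u * (g u - f u))"
    by (intro add_left_mono ennreal_leI)
  also have "\<dots> \<le> (\<integral>\<^sup>+u. ennreal (g u) \<partial>U)"
    by (rule sum_le_nn_integral_diff) (use assms in auto)
  finally show ?thesis .
qed

text \<open>One \<open>B\<close> serves every \<alpha>, since collisions do not depend on \<alpha>.
  The constants compare P with 2 * P: for \<alpha> < 1, P * (P^(\<alpha> - 1) - (2*P)^(\<alpha> -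
  1)) = (1 - 2^(\<alpha> - 1)) * P^\<alpha>, and in the Shannon case P * (ln (2*P) - ln P) = P * ln
  2; then P is bounded below by p(a)^h. For \<alpha> > 1 the function x^(\<alpha> - 1) increases, so
  U and S exchange sides.\<close>

lemma Bh_subset_gap:
  assumes G: "comm_group G" and X: "set_pmf X \<subseteq> carrier G" and h: "0 < h"
  obtains B where "B \<subseteq> set_pmf X" "Bh_set G h B"
    "\<And>F \<alpha>. finite F \<Longrightarrow> F \<subseteq> set_pmf X - B \<Longrightarrow> 0 < \<alpha> \<Longrightarrow> \<alpha> < 1 \<Longrightarrow>
       power_sum \<alpha> (S_law G h X) + ennreal (\<Sum>a\<in>F. (1 - 2 powr (\<alpha> - 1)) * pmf X a powr (real h * \<alpha>))
         \<le> power_sum \<alpha> (U_law h X)"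
    "\<And>F \<alpha>. finite F \<Longrightarrow> F \<subseteq> set_pmf X - B \<Longrightarrow> 1 < \<alpha> \<Longrightarrow>
       power_sum \<alpha> (U_law h X) + ennreal (\<Sum>a\<in>F. (2 powr (\<alpha> - 1) - 1) * pmf X a powr (real h * \<alpha>))
         \<le> power_sum \<alpha> (S_law G h X)"
    "\<And>F. finite F \<Longrightarrow> F \<subseteq> set_pmf X - B \<Longrightarrow>
       shannon_entropy (S_law G h X) + ennreal (\<Sum>a\<in>F. ln 2 * pmf X a ^ h) \<le> shannon_entropy (U_law h X)"
proof -
  let ?U = "U_law h X"
  define w where "w u = pmf (map_pmf (msum G) ?U) (msum G u)" for u
  obtain B v where B: "B \<subseteq> set_pmf X" "Bh_set G h B" and v: "inj_on v (set_pmf X - B)"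
    "\<And>a. a \<in> set_pmf X - B \<Longrightarrow> v a \<in> set_pmf ?U"
    "\<And>a. a \<in> set_pmf X - B \<Longrightarrow> pmf X a ^ h \<le> pmf ?U (v a)"
    "\<And>a. a \<in> set_pmf X - B \<Longrightarrow> 2 * pmf ?U (v a) \<le> w (v a)"
    unfolding w_def using collision_injection[OF X h] by metis
  have S: "S_law G h X = map_pmf (msum G) ?U" by (rule S_law_eq_msum_U_law[OF G X])
  have Pw: "pmf ?U u \<le> w u" for u
    using sum_pmf_le_pmf_map[of "{u}" "msum G" "msum G u" ?U] by (simp add: w_def)
  have w1: "w u \<le> 1" for u by (simp add: w_def pmf_le_1)
  have pows: "power_sum \<alpha> (S_law G h X) = (\<integral>\<^sup>+u. ennreal (w u powr (\<alpha> - 1)) \<partial>?U)" for \<alpha>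
    by (simp add: S power_sum_eq_nn_integral nn_integral_map_pmf w_def)
  have hpow: "pmf X a powr (real h * \<alpha>) = (pmf X a ^ h) powr \<alpha>" if "a \<in> set_pmf X" for a \<alpha>
    using pmf_positive[OF that] by (simp add: powr_powr[symmetric] powr_realpow)
  have scale: "(2 * x) powr (\<alpha> - 1) * x = 2 powr (\<alpha> - 1) * x powr \<alpha>" if "0 < x" for x \<alpha> :: real
    using that by (simp add: powr_mult powr_diff)
  have scale1: "x powr (\<alpha> - 1) * x = x powr \<alpha>" if "0 < x" for x \<alpha> :: real
    using that by (simp add: powr_diff)
  show thesis
  proof (rule that[OF B])
    fix F \<alpha> assume F: "finite F" "F \<subseteq> set_pmf X - B" and \<alpha>: "0 < (\<alpha>::real)" "\<alpha> < 1"
    have "(2::real) powr (\<alpha> - 1) \<le> 2 powr 0" using \<alpha> by (intro powr_mono) auto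
    then have "2 powr (\<alpha> - 1) \<le> (1::real)" by simp
    have c: "(1 - 2 powr (\<alpha> - 1)) * pmf X a powr (real h * \<alpha>) \<le>
        pmf ?U (v a) * (pmf ?U (v a) powr (\<alpha> - 1) - w (v a) powr (\<alpha> - 1))" if "a \<in> F" for a
    proof -
      have a: "a \<in> set_pmf X - B" using that F by auto
      have p: "0 < pmf ?U (v a)" using v(2)[OF a] by (rule pmf_positive)
      have "(1 - 2 powr (\<alpha> - 1)) * pmf X a powr (real h * \<alpha>) \<le> (1 - 2 powr (\<alpha> - 1)) * pmf ?U (v a) powr \<alpha>"
        using a v(3)[OF a] \<alpha> \<open>2 powr (\<alpha> - 1) \<le> 1\<close> by (auto simp: hpow intro!: mult_left_mono powr_mono2)
      also have "\<dots> = pmf ?U (v a) * (pmf ?U (v a) powr (\<alpha> - 1) - (2 * pmf ?U (v a)) powr (\<alpha> - 1))"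
        using scale[OF p, of \<alpha>] scale1[OF p, of \<alpha>] by (simp add: algebra_simps)
      also have "\<dots> \<le> pmf ?U (v a) * (pmf ?U (v a) powr (\<alpha> - 1) - w (v a) powr (\<alpha> - 1))"
        using v(4)[OF a] p \<alpha> by (intro mult_left_mono diff_mono order_refl powr_mono2') auto
      finally show ?thesis .
    qed
    show "power_sum \<alpha> (S_law G h X) + ennreal (\<Sum>a\<in>F. (1 - 2 powr (\<alpha> - 1)) * pmf X a powr (real h * \<alpha>))
         \<le> power_sum \<alpha> ?U"
      unfolding pows power_sum_eq_nn_integral[of \<alpha> ?U]
      by (rule sum_le_nn_integral_diff_inj[where v = v])
        (use F v c \<alpha> Pw in \<open>auto intro: inj_on_subset powr_mono2' simp: pmf_positive\<close>)
  next
    fix F \<alpha> assume F: "finite F" "F \<subseteq> set_pmf X - B" and \<alpha>: "1 < (\<alpha>::real)"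
    have "1 \<le> (2::real) powr (\<alpha> - 1)" using \<alpha> by (intro ge_one_powr_ge_zero) auto
    have c: "(2 powr (\<alpha> - 1) - 1) * pmf X a powr (real h * \<alpha>) \<le>
        pmf ?U (v a) * (w (v a) powr (\<alpha> - 1) - pmf ?U (v a) powr (\<alpha> - 1))" if "a \<in> F" for a
    proof -
      have a: "a \<in> set_pmf X - B" using that F by auto
      have p: "0 < pmf ?U (v a)" using v(2)[OF a] by (rule pmf_positive)
      have "(2 powr (\<alpha> - 1) - 1) * pmf X a powr (real h * \<alpha>) \<le> (2 powr (\<alpha> - 1) - 1) * pmf ?U (v a) powr \<alpha>"
        using a v(3)[OF a] \<alpha> \<open>1 \<le> 2 powr (\<alpha> - 1)\<close> by (auto simp: hpow intro!: mult_left_mono powr_mono2)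
      also have "\<dots> = pmf ?U (v a) * ((2 * pmf ?U (v a)) powr (\<alpha> - 1) - pmf ?U (v a) powr (\<alpha> - 1))"
        using scale[OF p, of \<alpha>] scale1[OF p, of \<alpha>] by (simp add: algebra_simps)
      also have "\<dots> \<le> pmf ?U (v a) * (w (v a) powr (\<alpha> - 1) - pmf ?U (v a) powr (\<alpha> - 1))"
        using v(4)[OF a] p \<alpha> by (intro mult_left_mono diff_mono order_refl powr_mono2) auto
      finally show ?thesis .
    qed
    show "power_sum \<alpha> ?U + ennreal (\<Sum>a\<in>F. (2 powr (\<alpha> - 1) - 1) * pmf X a powr (real h * \<alpha>))
         \<le> power_sum \<alpha> (S_law G h X)"
      unfolding pows power_sum_eq_nn_integral[of \<alpha> ?U]
      by (rule sum_le_nn_integral_diff_inj[where v = v])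
        (use F v c \<alpha> Pw in \<open>auto intro: inj_on_subset powr_mono2\<close>)
  next
    fix F assume F: "finite F" "F \<subseteq> set_pmf X - B"
    have sh: "shannon_entropy (S_law G h X) = (\<integral>\<^sup>+u. ennreal (- ln (w u)) \<partial>?U)"
      by (simp add: S shannon_entropy_eq_nn_integral nn_integral_map_pmf w_def)
    have wpos: "0 < w u" if "u \<in> set_pmf ?U" for u using Pw[of u] pmf_positive[OF that] by simp
    have c: "ln 2 * pmf X a ^ h \<le> pmf ?U (v a) * (- ln (pmf ?U (v a)) - - ln (w (v a)))" if "a \<in> F" for a
    proof -
      have a: "a \<in> set_pmf X - B" using that F by auto
      have p: "0 < pmf ?U (v a)" using v(2)[OF a] by (rule pmf_positive)
      have "ln 2 * pmf X a ^ h \<le> ln 2 * pmf ?U (v a)" using v(3)[OF a] by (intro mult_left_mono) auto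
      also have "\<dots> = pmf ?U (v a) * (- ln (pmf ?U (v a)) - - ln (2 * pmf ?U (v a)))"
        using p by (simp add: ln_mult)
      also have "\<dots> \<le> pmf ?U (v a) * (- ln (pmf ?U (v a)) - - ln (w (v a)))"
        using v(4)[OF a] p by (intro mult_left_mono diff_mono order_refl le_imp_neg_le) auto
      finally show ?thesis .
    qed
    show "shannon_entropy (S_law G h X) + ennreal (\<Sum>a\<in>F. ln 2 * pmf X a ^ h) \<le> shannon_entropy ?U"
      unfolding sh shannon_entropy_eq_nn_integral[of ?U]
    proof (rule sum_le_nn_integral_diff_inj[where v = v])
      show "- ln (w u) \<le> - ln (pmf ?U u)" if "u \<in> set_pmf ?U" for u
        using Pw[of u] pmf_positive[OF that] by simp
      show "0 \<le> - ln (w u)" if "u \<in> set_pmf ?U" for u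
        using w1[of u] wpos[OF that] by simp
    qed (use F v c in \<open>auto intro: inj_on_subset\<close>)
  qed
qed

subsection \<open>Laws on powers of a cyclic group\<close>

text \<open>The full power of Z/h with factors indexed by \<open>nat\<close>. Having infinitely many
  factors, one group has room for any number of light atoms.\<close>

definition cyclic_power :: "nat \<Rightarrow> (nat \<Rightarrow> nat) monoid" where
  "cyclic_power h = \<lparr>carrier = {f. \<forall>j. f j < h}, mult = (\<lambda>f g j. (f j + g j) mod h), one = (\<lambda>_. 0)\<rparr>"

text \<open>\<open>vertex 0\<close> is the neutral element and \<open>vertex (Suc j)\<close> generates the \<open>j\<close>-th factor.\<close>

definition vertex :: "nat \<Rightarrow> nat \<Rightarrow> nat" where
  "vertex i = (\<lambda>j. if i = Suc j then 1 else 0)"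

lemma comm_group_cyclic_power:
  assumes "0 < h"
  shows "comm_group (cyclic_power h)"
proof (rule comm_groupI)
  fix x assume "x \<in> carrier (cyclic_power h)"
  then have "(h - x j + x j) mod h = 0" for j
    by (simp add: cyclic_power_def less_imp_le)
  then show "\<exists>y\<in>carrier (cyclic_power h). y \<otimes>\<^bsub>cyclic_power h\<^esub> x = \<one>\<^bsub>cyclic_power h\<^esub>"
    \<comment> \<open>The outer \<open>mod h\<close> matters where \<open>x j = 0\<close>, since
      \<open>h\<close> itself is not a residue below \<open>h\<close>.\<close>
    using assms by (intro bexI[of _ "\<lambda>j. (h - x j) mod h"])
      (auto simp: cyclic_power_def mod_add_left_eq)
qed (use assms in \<open>auto simp: cyclic_power_def fun_eq_iff mod_add_left_eq mod_add_right_eq add_ac\<close>)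

lemma inj_vertex: "inj vertex"
proof (rule injI)
  fix i k assume "vertex i = vertex k"
  then have "i = Suc j \<longleftrightarrow> k = Suc j" for j
    unfolding vertex_def fun_eq_iff by (metis zero_neq_one)
  then show "i = k" by (metis not0_implies_Suc)
qed

lemma vertex_carrier: "2 \<le> h \<Longrightarrow> vertex i \<in> carrier (cyclic_power h)"
  by (simp add: cyclic_power_def vertex_def)

lemma foldr_cyclic_power:
  "foldr (\<otimes>\<^bsub>cyclic_power h\<^esub>) xs \<one>\<^bsub>cyclic_power h\<^esub> = (\<lambda>j. (\<Sum>x\<leftarrow>xs. x j) mod h)"
  by (induction xs) (auto simp: cyclic_power_def mod_add_right_eq)

text \<open>No coordinate sees \<open>vertex 0\<close>; its multiplicity has to be recovered from
  the total size of the multiset.\<close>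

lemma sum_list_vertex: "(\<Sum>x\<leftarrow>map vertex xs. x j) = count (mset xs) (Suc j)"
  by (induction xs) (auto simp: vertex_def)

text \<open>Multiplication by \<open>h\<close> annihilates the group, so \<open>h\<close> copies of
  \<open>x\<close> and \<open>h\<close> copies of \<open>y\<close> have the same sum.\<close>

lemma Bh_set_cyclic_power_subsingleton:
  assumes h: "0 < h" and B: "Bh_set (cyclic_power h) h B" and "x \<in> B" "y \<in> B"
  shows "x = y"
proof -
  have G: "comm_group (cyclic_power h)" using h by (rule comm_group_cyclic_power)
  have Bc: "B \<subseteq> carrier (cyclic_power h)" using B by (simp add: Bh_set_def)
  have "msum (cyclic_power h) (replicate_mset h z) = (\<lambda>j. 0)" if "z \<in> B" for z
    using msum_mset[OF G, of "replicate h z"] that Bc h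
    unfolding foldr_cyclic_power by (auto simp: sum_list_replicate)
  moreover have "replicate_mset h z \<in> multisets_of_size B h" if "z \<in> B" for z
    using that h by (simp add: multisets_of_size_def)
  ultimately have "replicate_mset h x = replicate_mset h y"
    using B assms(3,4) unfolding Bh_set_def by (metis inj_onD)
  then show ?thesis using h by (metis count_replicate_mset less_numeral_extra(3))
qed

text \<open>In a multiset of size \<open>h\<close>, reduction modulo \<open>h\<close> loses a
  multiplicity only if it equals \<open>h\<close>, that is, for a constant multiset. Otherwise the
  multiplicities at positive indices are determined, and the one at \<open>0\<close> follows from
  the size.\<close>

lemma count_mod_collision:
  fixes m m' :: "nat multiset"
  assumes size: "size m = h" "size m' = h" and eq: "\<And>j. count m (Suc j) mod h = count m' (Suc j) mod h"
    and ne: "m \<noteq> m'"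
  shows "\<exists>i. m = replicate_mset h i"
proof (rule ccontr)
  have pureI: "u = replicate_mset h i" if "size u = h" "h \<le> count u i" for u :: "nat multiset" and i
    using that by (metis count_le_replicate_mset_subset_eq size_replicate_mset subset_mset.le_imp_less_or_eq
        mset_subset_size less_irrefl)
  assume np: "\<nexists>i. m = replicate_mset h i"
  then have lt: "count m i < h" for i using pureI[OF size(1), of i] np by force
  \<comment> \<open>If \<open>m'\<close> were constant, its positive indices would have
    multiplicities 0 modulo \<open>h\<close>; those of \<open>m\<close>, being below
    \<open>h\<close>, would vanish, and \<open>m\<close> would be constant at
    \<open>0\<close>.\<close>
  have lt': "count m' i < h" for i
  proof (rule ccontr)
    assume "\<not> count m' i < h"
    then have m': "m' = replicate_mset h i" using pureI[OF size(2), of i] by force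
    have "count m (Suc j) = 0" for j
      using eq[of j] lt[of "Suc j"] by (simp add: m' split: if_splits)
    then have "set_mset m \<subseteq> {0}" by (metis count_eq_zero_iff not0_implies_Suc insertCI subsetI)
    then have "m = replicate_mset h 0" using size(1) by (metis set_mset_subset_singletonD)
    then show False using np by blast
  qed
  have c: "count m (Suc j) = count m' (Suc j)" for j using eq[of j] lt lt' by simp
  have "filter_mset (\<lambda>i. i \<noteq> 0) m = filter_mset (\<lambda>i. i \<noteq> 0) m'"
  proof (rule multiset_eqI)
    show "count (filter_mset (\<lambda>i. i \<noteq> 0) m) x = count (filter_mset (\<lambda>i. i \<noteq> 0) m') x" for x
      by (cases x) (simp_all add: c)
  qed
  moreover have "size u = size (filter_mset (\<lambda>i. i \<noteq> 0) u) + count u 0" for u :: "nat multiset"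
    by (induction u) auto
  ultimately have c0: "count m 0 = count m' 0" using size by (metis add_left_cancel)
  have "m = m'"
  proof (rule multiset_eqI)
    show "count m x = count m' x" for x by (cases x) (simp_all add: c c0)
  qed
  then show False using ne by simp
qed

lemma S_law_vertex:
  assumes "2 \<le> h"
  shows "S_law (cyclic_power h) h (map_pmf vertex Y) = map_pmf (\<lambda>m j. count m (Suc j) mod h) (U_law h Y)"
  unfolding S_law_def U_law_def replicate_map_pmf pmf.map_comp
  by (simp only: o_def foldr_cyclic_power sum_list_vertex)

lemma mset_eq_replicate_list: "mset xs = replicate_mset n a \<longleftrightarrow> xs = replicate n a"
proof
  assume eq: "mset xs = replicate_mset n a"
  then have "length xs = n" by (metis size_mset size_replicate_mset)
  moreover have "\<forall>x\<in>set xs. x = a" using eq by (metis in_replicate_mset set_mset_mset)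
  ultimately show "xs = replicate n a" by (metis replicate_eqI)
qed simp

text \<open>A constant multiset has only one ordering, so no multinomial factor appears.\<close>

lemma pmf_U_law_replicate_mset: "pmf (U_law h Y) (replicate_mset h i) = pmf Y i ^ h"
proof -
  have "mset -` {replicate_mset h i} = {replicate h i}"
    by (auto simp: mset_eq_replicate_list)
  then have "pmf (U_law h Y) (replicate_mset h i) = pmf (replicate_pmf h Y) (replicate h i)"
    by (simp add: U_law_def pmf_map measure_pmf_single)
  also have "\<dots> = pmf Y i ^ h" by (simp add: pmf_replicate_pmf)
  finally show ?thesis .
qed

lemma infsum_pmf_finite:
  fixes g :: "real \<Rightarrow> real"
  assumes "finite (set_pmf Z)" "g 0 = 0" "\<And>x. 0 \<le> x \<Longrightarrow> x \<le> 1 \<Longrightarrow> 0 \<le> g x"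
  shows "(\<Sum>\<^sub>\<infinity>z. ennreal (g (pmf Z z))) = ennreal (\<Sum>z\<in>set_pmf Z. g (pmf Z z))"
proof -
  have "(\<Sum>\<^sub>\<infinity>z. ennreal (g (pmf Z z))) = (\<Sum>\<^sub>\<infinity>z\<in>set_pmf Z. ennreal (g (pmf Z z)))"
    by (rule infsum_cong_neutral) (use assms in \<open>auto simp: set_pmf_iff\<close>)
  also have "\<dots> = ennreal (\<Sum>z\<in>set_pmf Z. g (pmf Z z))"
    using assms by (simp add: sum_ennreal pmf_le_1)
  finally show ?thesis .
qed

text \<open>\<open>R\<close> is the share of the non-constant multisets, which are determined by
  their sums and so contribute equally on both sides. The constant ones all merge into the atom of S
  at the neutral element. A general \<open>g\<close> covers the power sums and the Shannon entropy
  at once.\<close>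

lemma vertex_laws:
  fixes g :: "real \<Rightarrow> real"
  assumes h: "2 \<le> h" and fin: "finite (set_pmf Y)"
    and g: "g 0 = 0" "\<And>x. 0 \<le> x \<Longrightarrow> x \<le> 1 \<Longrightarrow> 0 \<le> g x"
  obtains R where "0 \<le> R"
    "(\<Sum>\<^sub>\<infinity>u. ennreal (g (pmf (U_law h (map_pmf vertex Y)) u))) = ennreal (R + (\<Sum>i\<in>set_pmf Y. g (pmf Y i ^ h)))"
    "(\<Sum>\<^sub>\<infinity>s. ennreal (g (pmf (S_law (cyclic_power h) h (map_pmf vertex Y)) s)))
      = ennreal (R + g (\<Sum>i\<in>set_pmf Y. pmf Y i ^ h))"
proof -
  let ?U = "U_law h Y" and ?t = "\<lambda>m j. count m (Suc j) mod h"
  let ?S = "map_pmf ?t ?U"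
  define P where "P = replicate_mset h ` set_pmf Y"
  define Q where "Q = set_pmf ?U - P"
  have finU: "finite (set_pmf ?U)" using fin by (simp add: set_pmf_U_law finite_multisets_of_size)
  have PU: "P \<subseteq> set_pmf ?U" using h by (auto simp: P_def set_pmf_U_law multisets_of_size_def)
  have injr: "inj_on (replicate_mset h) A" for A :: "nat set"
    using h by (intro inj_onI) (metis count_replicate_mset not_numeral_le_zero)
  have tP: "?t m = (\<lambda>j. 0)" if "m \<in> P" for m using that by (auto simp: P_def)
  have pure: "m \<in> P" if "m = replicate_mset h i" "m \<in> set_pmf ?U" for m i
    using that h by (auto simp: P_def set_pmf_U_law multisets_of_size_def split: if_splits)
  have tQ: "m = m'" if "m \<in> Q" "m' \<in> set_pmf ?U" "?t m = ?t m'" for m m'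
  proof (rule ccontr)
    have eq: "count m (Suc j) mod h = count m' (Suc j) mod h" for j using fun_cong[OF that(3), of j] .
    assume "m \<noteq> m'"
    moreover have "size m = h" "size m' = h"
      using that by (simp_all add: Q_def set_pmf_U_law multisets_of_size_def)
    ultimately obtain i where "m = replicate_mset h i"
      using count_mod_collision[of m h m', OF _ _ eq] by blast
    then show False using pure that(1) by (auto simp: Q_def)
  qed
  obtain i0 where i0: "i0 \<in> set_pmf Y" using set_pmf_not_empty by fast
  then have i0P: "replicate_mset h i0 \<in> P" by (simp add: P_def)
  have t0: "?t m \<noteq> (\<lambda>j. 0)" if "m \<in> Q" for m
    using tQ[OF that, of "replicate_mset h i0"] tP[OF i0P] i0P PU that by (auto simp: Q_def)
  have sP: "(\<Sum>m\<in>P. f (pmf ?U m)) = (\<Sum>i\<in>set_pmf Y. f (pmf Y i ^ h))" for f :: "real \<Rightarrow> real"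
    unfolding P_def by (simp add: sum.reindex[OF injr] pmf_U_law_replicate_mset)
  have setU: "set_pmf ?U = P \<union> Q" "P \<inter> Q = {}" "finite P" "finite Q"
    using PU finU by (auto simp: Q_def intro: finite_subset)
  have setS: "set_pmf ?S = insert (\<lambda>j. 0) (?t ` Q)"
    using i0P tP by (auto simp: setU(1) image_Un)
  have pS0: "pmf ?S (\<lambda>j. 0) = (\<Sum>i\<in>set_pmf Y. pmf Y i ^ h)"
  proof -
    have "pmf ?S (\<lambda>j. 0) = measure_pmf.prob ?U ((?t -` {\<lambda>j. 0}) \<inter> set_pmf ?U)"
      by (simp add: pmf_map measure_Int_set_pmf)
    also have "(?t -` {\<lambda>j. 0}) \<inter> set_pmf ?U = P"
      using tP t0 PU by (auto simp: Q_def)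
    also have "measure_pmf.prob ?U P = (\<Sum>m\<in>P. pmf ?U m)"
      using setU by (simp add: measure_measure_pmf_finite)
    finally show ?thesis using sP[of "\<lambda>x. x"] by simp
  qed
  have pSQ: "pmf ?S (?t m) = pmf ?U m" if "m \<in> Q" for m
  proof -
    have "pmf ?S (?t m) = measure_pmf.prob ?U ((?t -` {?t m}) \<inter> set_pmf ?U)"
      by (simp add: pmf_map measure_Int_set_pmf)
    also have "(?t -` {?t m}) \<inter> set_pmf ?U = {m}"
      using tQ[OF that] that by (auto simp: Q_def) metis
    finally show ?thesis by (simp add: measure_pmf_single)
  qed
  have injt: "inj_on ?t Q" using tQ by (intro inj_onI) (auto simp: Q_def)
  define R where "R = (\<Sum>m\<in>Q. g (pmf ?U m))"
  have "(\<Sum>\<^sub>\<infinity>u. ennreal (g (pmf (U_law h (map_pmf vertex Y)) u))) = (\<Sum>\<^sub>\<infinity>m. ennreal (g (pmf ?U m)))"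
  proof -
    have "U_law h (map_pmf vertex Y) = map_pmf (image_mset vertex) ?U"
      by (simp add: U_law_def replicate_map_pmf pmf.map_comp o_def)
    moreover have "inj_on (image_mset vertex) (set_pmf ?U)"
      using inj_on_image_mset[OF inj_vertex] by (rule inj_on_subset) simp
    ultimately show ?thesis using infsum_map_pmf_inj[of "image_mset vertex" ?U "\<lambda>x. ennreal (g x)"] g by simp
  qed
  also have "\<dots> = ennreal (\<Sum>m\<in>set_pmf ?U. g (pmf ?U m))" by (rule infsum_pmf_finite) (fact finU g)+
  also have "(\<Sum>m\<in>set_pmf ?U. g (pmf ?U m)) = R + (\<Sum>i\<in>set_pmf Y. g (pmf Y i ^ h))"
    unfolding setU(1) using setU by (simp add: sum.union_disjoint sP R_def)
  finally have 1: "(\<Sum>\<^sub>\<infinity>u. ennreal (g (pmf (U_law h (map_pmf vertex Y)) u)))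
      = ennreal (R + (\<Sum>i\<in>set_pmf Y. g (pmf Y i ^ h)))" .
  have "(\<Sum>\<^sub>\<infinity>s. ennreal (g (pmf ?S s))) = ennreal (\<Sum>s\<in>set_pmf ?S. g (pmf ?S s))"
    by (rule infsum_pmf_finite) (use finU g in auto)
  also have "(\<Sum>s\<in>set_pmf ?S. g (pmf ?S s)) = g (pmf ?S (\<lambda>j. 0)) + (\<Sum>s\<in>?t ` Q. g (pmf ?S s))"
    unfolding setS by (rule sum.insert) (use setU t0 in \<open>force+\<close>)
  also have "(\<Sum>s\<in>?t ` Q. g (pmf ?S s)) = R"
    by (simp add: sum.reindex[OF injt] pSQ R_def)
  finally have 2: "(\<Sum>\<^sub>\<infinity>s. ennreal (g (pmf ?S s))) = ennreal (R + g (\<Sum>i\<in>set_pmf Y. pmf Y i ^ h))"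
    by (simp add: pS0 add.commute)
  show thesis
    by (rule that[of R]) (use 1 2 g in \<open>auto simp: S_law_vertex[OF h] R_def pmf_le_1 intro: sum_nonneg\<close>)
qed

text \<open>A \<open>B\<^sub>h\<close> set here has at most one element, so its mass is at most that
  of the largest atom.\<close>

lemma Bh_defect_vertex_ge:
  assumes h: "0 < h" and q: "\<And>i. pmf Y i \<le> q"
  shows "1 - q \<le> Bh_defect h (cyclic_power h) (map_pmf vertex Y)"
proof -
  have "measure_pmf.prob (map_pmf vertex Y) B \<le> q"
    if B: "B \<subseteq> set_pmf (map_pmf vertex Y)" "Bh_set (cyclic_power h) h B" for B
  proof (cases "B = {}")
    case True
    then show ?thesis using order_trans[OF pmf_nonneg q] by simp
  next
    case False
    then obtain i where i: "vertex i \<in> B" using B by auto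
    then have "B = {vertex i}" using Bh_set_cyclic_power_subsingleton[OF h B(2)] by blast
    then show ?thesis using q[of i] by (simp add: measure_pmf_single pmf_map_inj'[OF inj_vertex] del: measure_map_pmf)
  qed
  then have "(SUP B \<in> {B. B \<subseteq> set_pmf (map_pmf vertex Y) \<and> Bh_set (cyclic_power h) h B}.
      measure_pmf.prob (map_pmf vertex Y) B) \<le> q"
    by (intro cSUP_least) (use Bh_set_empty[OF h] in auto)
  then show ?thesis by (simp add: Bh_defect_def)
qed

text \<open>A heavy atom at the neutral element and \<open>N\<close> light ones of total mass \<open>d\<close>.\<close>

lemma spike_pmf:
  assumes h: "2 \<le> h" and N: "0 < N" and d: "0 < d" "d < 1" "d / real N \<le> 1 - d"
  obtains G :: "(nat \<Rightarrow> nat) monoid" and X where "comm_group G" "set_pmf X \<subseteq> carrier G" "d \<le> Bh_defect h G X"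
    "\<And>g :: real \<Rightarrow> real. g 0 = 0 \<Longrightarrow> (\<And>x. 0 \<le> x \<Longrightarrow> x \<le> 1 \<Longrightarrow> 0 \<le> g x) \<Longrightarrow>
       (\<Sum>\<^sub>\<infinity>x. ennreal (g (pmf X x))) = ennreal (g (1 - d) + real N * g (d / real N))"
    "\<And>g :: real \<Rightarrow> real. g 0 = 0 \<Longrightarrow> (\<And>x. 0 \<le> x \<Longrightarrow> x \<le> 1 \<Longrightarrow> 0 \<le> g x) \<Longrightarrow>
       \<exists>R\<ge>0. (\<Sum>\<^sub>\<infinity>u. ennreal (g (pmf (U_law h X) u)))
             = ennreal (R + g ((1 - d) ^ h) + real N * g ((d / real N) ^ h)) \<and>
           (\<Sum>\<^sub>\<infinity>s. ennreal (g (pmf (S_law G h X) s)))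
             = ennreal (R + g ((1 - d) ^ h + real N * (d / real N) ^ h))"
proof -
  define Y where "Y = bind_pmf (bernoulli_pmf d) (\<lambda>b. if b then pmf_of_set {1..N} else return_pmf 0)"
  have pY: "pmf Y i = (if i = 0 then 1 - d else if i \<le> N then d / real N else 0)" for i
    using N d by (simp add: Y_def pmf_bind pmf_of_set indicator_def)
  have setY: "set_pmf Y = insert 0 {1..N}" using N d by (auto simp: set_pmf_iff pY)
  have sumY: "(\<Sum>i\<in>set_pmf Y. f (pmf Y i)) = f (1 - d) + real N * f (d / real N)" for f :: "real \<Rightarrow> real"
    unfolding setY by (subst sum.insert) (auto simp: pY)
  let ?X = "map_pmf vertex Y" and ?G = "cyclic_power h"
  show thesis
  proof (rule that)
    show "comm_group ?G" using h by (intro comm_group_cyclic_power) simp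
    show "set_pmf ?X \<subseteq> carrier ?G" using vertex_carrier[OF h] by auto
    \<comment> \<open>The hypothesis \<open>d / real N \<le> 1 - d\<close> makes the neutral element
      the largest atom.\<close>
    show "d \<le> Bh_defect h ?G ?X"
      using Bh_defect_vertex_ge[of h Y "1 - d"] h d by (simp add: pY)
  next
    fix g :: "real \<Rightarrow> real" assume g: "g 0 = 0" "\<And>x. 0 \<le> x \<Longrightarrow> x \<le> 1 \<Longrightarrow> 0 \<le> g x"
    have "(\<Sum>\<^sub>\<infinity>x. ennreal (g (pmf ?X x))) = (\<Sum>\<^sub>\<infinity>x. ennreal (g (pmf Y x)))"
      using infsum_map_pmf_inj[of vertex Y "\<lambda>x. ennreal (g x)"] g inj_vertex by (simp add: inj_on_subset)
    also have "\<dots> = ennreal (\<Sum>i\<in>set_pmf Y. g (pmf Y i))"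
      by (rule infsum_pmf_finite) (use g setY in auto)
    finally show "(\<Sum>\<^sub>\<infinity>x. ennreal (g (pmf ?X x))) = ennreal (g (1 - d) + real N * g (d / real N))"
      by (simp add: sumY)
  next
    fix g :: "real \<Rightarrow> real" assume g: "g 0 = 0" "\<And>x. 0 \<le> x \<Longrightarrow> x \<le> 1 \<Longrightarrow> 0 \<le> g x"
    have fin: "finite (set_pmf Y)" by (simp add: setY)
    show "\<exists>R\<ge>0. (\<Sum>\<^sub>\<infinity>u. ennreal (g (pmf (U_law h ?X) u)))
             = ennreal (R + g ((1 - d) ^ h) + real N * g ((d / real N) ^ h)) \<and>
           (\<Sum>\<^sub>\<infinity>s. ennreal (g (pmf (S_law ?G h ?X) s)))
             = ennreal (R + g ((1 - d) ^ h + real N * (d / real N) ^ h))"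
    proof (rule vertex_laws[of h Y g, OF h fin g])
      show ?thesis if "0 \<le> R"
        "(\<Sum>\<^sub>\<infinity>u. ennreal (g (pmf (U_law h ?X) u))) = ennreal (R + (\<Sum>i\<in>set_pmf Y. g (pmf Y i ^ h)))"
        "(\<Sum>\<^sub>\<infinity>s. ennreal (g (pmf (S_law ?G h ?X) s))) = ennreal (R + g (\<Sum>i\<in>set_pmf Y. pmf Y i ^ h))" for R
        using that sumY[of "\<lambda>x. x ^ h"] sumY[of "\<lambda>x. g (x ^ h)"] by (intro exI[of _ R]) (simp add: add.assoc)
    qed
  qed
qed

subsection \<open>Bounds on the defect\<close>

lemma Bh_defect_le_prob:
  assumes "B \<subseteq> set_pmf X" "Bh_set G h B"
  shows "Bh_defect h G X \<le> 1 - measure_pmf.prob X B"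
proof -
  have "measure_pmf.prob X B \<le> (SUP B \<in> {B. B \<subseteq> set_pmf X \<and> Bh_set G h B}. measure_pmf.prob X B)"
    using assms by (intro cSUP_upper) (auto intro!: bdd_aboveI2[where M = 1])
  then show ?thesis by (simp add: Bh_defect_def)
qed

lemma Bh_defect_le_finite_sums:
  assumes "B \<subseteq> set_pmf X" "Bh_set G h B"
    and "\<And>F. finite F \<Longrightarrow> F \<subseteq> set_pmf X - B \<Longrightarrow> sum (pmf X) F \<le> b"
  shows "Bh_defect h G X \<le> b"
proof -
  have "1 - measure_pmf.prob X B = measure_pmf.prob X (- B)"
    using measure_pmf.prob_compl[of B X] by (simp add: Compl_eq_Diff_UNIV)
  also have "\<dots> = measure_pmf.prob X (- B \<inter> set_pmf X)" by (simp add: measure_Int_set_pmf)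
  also have "\<dots> \<le> b" by (rule pmf_prob_le_finite_sums) (use assms(3) in auto)
  finally show ?thesis using Bh_defect_le_prob[OF assms(1,2)] by simp
qed

section \<open>Upper bounds in the three ranges of \<alpha>\<close>

lemma power_sum_pos: "0 < power_sum \<alpha> Y"
proof -
  obtain y where "y \<in> set_pmf Y" using set_pmf_not_empty by fast
  then have "0 < ennreal (\<Sum>a\<in>{y}. pmf Y a powr \<alpha>)" by (simp add: set_pmf_iff)
  also have "\<dots> \<le> power_sum \<alpha> Y" by (rule sum_pmf_le_power_sum) simp
  finally show ?thesis .
qed

lemma enn2real_power_sum_pos: "power_sum \<alpha> Y \<noteq> \<infinity> \<Longrightarrow> 0 < enn2real (power_sum \<alpha> Y)"
  using power_sum_pos[of \<alpha> Y] by (simp add: enn2real_positive_iff less_top)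

lemma power_sum_le_1:
  assumes "1 \<le> \<alpha>"
  shows "power_sum \<alpha> Y \<le> 1"
proof -
  have "power_sum \<alpha> Y \<le> (\<integral>\<^sup>+y. 1 \<partial>Y)"
    unfolding power_sum_eq_nn_integral
    by (intro nn_integral_mono) (use assms in \<open>auto simp: pmf_le_1 intro!: powr_le1\<close>)
  then show ?thesis by simp
qed

text \<open>The gap only controls the ratio of the power sums: MU \<le> MS * exp ((1 - \<alpha>) *
  C). To bound the difference MU - MS, which dominates the collisions, one needs a bound for MU
  itself, and this is where M(U) \<le> M(X)^h and the entropy bound enter.\<close>

lemma admissible_power_sums:
  assumes adm: "admissible \<alpha> \<alpha> D h C G X" and \<alpha>: "0 < \<alpha>" "\<alpha> < 1" and h: "0 < h"
  obtains B where "B \<subseteq> set_pmf X" "Bh_set G h B"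
    "\<And>F. finite F \<Longrightarrow> F \<subseteq> set_pmf X - B \<Longrightarrow> (\<Sum>a\<in>F. pmf X a powr \<alpha>) \<le> exp ((1 - \<alpha>) * D)"
    "\<And>F. finite F \<Longrightarrow> F \<subseteq> set_pmf X - B \<Longrightarrow> (\<Sum>a\<in>F. pmf X a powr (real h * \<alpha>))
       \<le> exp ((1 - \<alpha>) * D) ^ h * (exp ((1 - \<alpha>) * C) - 1) / (1 - 2 powr (\<alpha> - 1))"
proof -
  let ?U = "U_law h X" and ?S = "S_law G h X"
  have G: "comm_group G" and X: "set_pmf X \<subseteq> carrier G" and fU: "power_sum \<alpha> ?U \<noteq> \<infinity>"
    and gap: "renyi_entropy \<alpha> ?U - renyi_entropy \<alpha> ?S \<le> ereal C" and D: "renyi_entropy \<alpha> X \<le> ereal D"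
    using adm \<alpha> by (auto simp: admissible_def finite_entropy_cond_def entropy_gap_def)
  obtain B where B: "B \<subseteq> set_pmf X" "Bh_set G h B" and sums:
    "\<And>F. finite F \<Longrightarrow> F \<subseteq> set_pmf X - B \<Longrightarrow>
       power_sum \<alpha> ?S + ennreal (\<Sum>a\<in>F. (1 - 2 powr (\<alpha> - 1)) * pmf X a powr (real h * \<alpha>)) \<le> power_sum \<alpha> ?U"
    using Bh_subset_gap[OF G X h] \<alpha> by metis
  have fX: "power_sum \<alpha> X \<noteq> \<infinity>" using D \<alpha> by (auto simp: renyi_entropy_def split: if_splits)
  have fS: "power_sum \<alpha> ?S \<noteq> \<infinity>"
    using sums[of "{}"] fU by (auto simp: top_unique)
  define MX MU MS where "MX = enn2real (power_sum \<alpha> X)" "MU = enn2real (power_sum \<alpha> ?U)" "MS = enn2real (power_sum \<alpha> ?S)"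
  have ps: "power_sum \<alpha> X = ennreal MX" "power_sum \<alpha> ?U = ennreal MU" "power_sum \<alpha> ?S = ennreal MS"
    using fX fU fS by (auto simp: MX_MU_MS_def less_top)
  have pos: "0 < MX" "0 < MU" "0 < MS"
    using fX fU fS enn2real_power_sum_pos by (auto simp: MX_MU_MS_def)
  have "ln MX / (1 - \<alpha>) \<le> D" using D \<alpha> fX by (simp add: renyi_entropy_def MX_MU_MS_def)
  then have MX: "MX \<le> exp ((1 - \<alpha>) * D)"
    using pos \<alpha> by (simp add: ln_ge_iff[symmetric] pos_divide_le_eq mult.commute) (metis exp_le_cancel_iff exp_ln)
  have "ln MU / (1 - \<alpha>) - ln MS / (1 - \<alpha>) \<le> C"
    using gap \<alpha> fU fS by (simp add: renyi_entropy_def MX_MU_MS_def)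
  then have "ln MU \<le> ln MS + (1 - \<alpha>) * C"
    using \<alpha> by (simp add: diff_divide_distrib[symmetric] pos_divide_le_eq algebra_simps)
  then have "exp (ln MU) \<le> exp (ln MS + (1 - \<alpha>) * C)" by simp
  then have MU: "MU \<le> MS * exp ((1 - \<alpha>) * C)" using pos by (simp add: exp_add)
  have "ennreal MU \<le> ennreal MX ^ h" using power_sum_U_law_le[of \<alpha> h X] \<alpha> ps by simp
  then have "MU \<le> MX ^ h" using pos by (simp add: ennreal_power)
  also have "\<dots> \<le> exp ((1 - \<alpha>) * D) ^ h" using MX pos by (intro power_mono) auto
  finally have MUh: "MU \<le> exp ((1 - \<alpha>) * D) ^ h" .
  have F2: "(1 - 2 powr (\<alpha> - 1)) * (\<Sum>a\<in>F. pmf X a powr (real h * \<alpha>)) \<le> MU - MS"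
    and F1: "(\<Sum>a\<in>F. pmf X a powr \<alpha>) \<le> MX" if "finite F" "F \<subseteq> set_pmf X - B" for F
  proof -
    have "(2::real) powr (\<alpha> - 1) \<le> 2 powr 0" using \<alpha> by (intro powr_mono) auto
    then have "0 \<le> (1 - 2 powr (\<alpha> - 1)) * (\<Sum>a\<in>F. pmf X a powr (real h * \<alpha>))"
      by (auto intro!: mult_nonneg_nonneg sum_nonneg)
    moreover have "ennreal MS + ennreal ((1 - 2 powr (\<alpha> - 1)) * (\<Sum>a\<in>F. pmf X a powr (real h * \<alpha>))) \<le> ennreal MU"
      using sums[OF that] ps by (simp add: sum_distrib_left)
    ultimately show "(1 - 2 powr (\<alpha> - 1)) * (\<Sum>a\<in>F. pmf X a powr (real h * \<alpha>)) \<le> MU - MS"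
      using pos by (simp add: ennreal_plus[symmetric] del: ennreal_plus)
    show "(\<Sum>a\<in>F. pmf X a powr \<alpha>) \<le> MX"
      using sum_pmf_le_power_sum[OF that(1), of X \<alpha>] ps pos by simp
  qed
  have 2: "(2::real) powr (\<alpha> - 1) < 1"
    using powr_less_mono[of "\<alpha> - 1" 0 "2::real"] \<alpha> by simp
  have MSU: "0 \<le> MU - MS" using F2[of "{}"] by simp
  \<comment> \<open>Follows from MS \<le> MU \<le> MS * exp ((1 - \<alpha>) * C), the first
    inequality being the collision bound for the empty set.\<close>
  have e: "1 \<le> exp ((1 - \<alpha>) * C)"
    using MU MSU pos by (metis diff_ge_0_iff_ge dual_order.trans mult_le_cancel_left1 not_le order_less_imp_le)
  have "MU - MS \<le> MS * (exp ((1 - \<alpha>) * C) - 1)" using MU by (simp add: algebra_simps)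
  also have "\<dots> \<le> exp ((1 - \<alpha>) * D) ^ h * (exp ((1 - \<alpha>) * C) - 1)"
    using MSU MUh e by (intro mult_right_mono) auto
  finally have "(1 - 2 powr (\<alpha> - 1)) * (\<Sum>a\<in>F. pmf X a powr (real h * \<alpha>))
      \<le> exp ((1 - \<alpha>) * D) ^ h * (exp ((1 - \<alpha>) * C) - 1)" if "finite F" "F \<subseteq> set_pmf X - B" for F
    using F2[OF that] by simp
  then show thesis
    using that[OF B] F1 MX 2 by (force simp: pos_le_divide_eq mult.commute)
qed

text \<open>The inclusion of l^s in l^1: each p^s is at most E and 1/s - 1 \<ge> 0, so p = p^s *
  (p^s)^(1/s - 1) \<le> p^s * E^(1/s - 1).\<close>

lemma sum_le_powr_of_sum_powr_le:
  fixes p :: "'a \<Rightarrow> real"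
  assumes "finite F" and p: "\<And>a. a \<in> F \<Longrightarrow> 0 < p a" and s: "0 < s" "s \<le> 1"
    and E: "(\<Sum>a\<in>F. p a powr s) \<le> E"
  shows "sum p F \<le> E powr (1 / s)"
proof (cases "F = {}")
  case True
  then show ?thesis by simp
next
  case False
  then have Epos: "0 < E" using E p assms(1) by (smt (verit) powr_gt_zero sum_pos)
  have le: "p a \<le> p a powr s * E powr (1 / s - 1)" if a: "a \<in> F" for a
  proof -
    have "p a powr s \<le> (\<Sum>a\<in>F. p a powr s)"
      using assms(1) a by (intro member_le_sum) auto
    then have "p a powr s \<le> E" using E by simp
    then have "(p a powr s) powr (1 / s - 1) \<le> E powr (1 / s - 1)"
      using s by (intro powr_mono2) (auto simp: field_simps)
    moreover have "s * (1 / s - 1) = 1 - s" using s by (simp add: field_simps)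
    ultimately have "p a powr s * p a powr (1 - s) \<le> p a powr s * E powr (1 / s - 1)"
      by (intro mult_left_mono) (simp_all add: powr_powr)
    then show ?thesis using p[OF a] by (simp add: powr_add[symmetric])
  qed
  have "sum p F \<le> (\<Sum>a\<in>F. p a powr s) * E powr (1 / s - 1)"
    unfolding sum_distrib_right by (rule sum_mono) (rule le)
  also have "\<dots> \<le> E * E powr (1 / s - 1)" using E by (intro mult_right_mono) auto
  also have "\<dots> = E powr (1 / s)" using Epos by (simp add: powr_diff)
  finally show ?thesis .
qed

text \<open>Atoms of size at most \<open>t\<close> are charged to the \<alpha>-sum, the others to
  the \<open>s\<close>-sum; \<open>t\<close> is left free to be balanced later.\<close>

lemma sum_le_threshold:
  fixes p :: "'a \<Rightarrow> real"
  assumes p: "\<And>a. a \<in> F \<Longrightarrow> 0 < p a" and s: "\<alpha> \<le> 1" "1 \<le> s" and t: "0 < t"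
    and K: "(\<Sum>a\<in>F. p a powr \<alpha>) \<le> K" and E: "(\<Sum>a\<in>F. p a powr s) \<le> E"
  shows "sum p F \<le> t powr (1 - \<alpha>) * K + t powr (1 - s) * E"
proof -
  have le: "p a \<le> t powr (1 - \<alpha>) * p a powr \<alpha> + t powr (1 - s) * p a powr s" if a: "a \<in> F" for a
  proof (cases "p a \<le> t")
    case True
    have "p a = p a powr (1 - \<alpha>) * p a powr \<alpha>" using p[OF a] by (simp add: powr_add[symmetric])
    also have "\<dots> \<le> t powr (1 - \<alpha>) * p a powr \<alpha>"
      using True p[OF a] s by (intro mult_right_mono powr_mono2) auto
    finally show ?thesis using t by (simp add: add_increasing2)
  next
    case False
    have "p a = p a powr (1 - s) * p a powr s" using p[OF a] by (simp add: powr_add[symmetric])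
    also have "\<dots> \<le> t powr (1 - s) * p a powr s"
      using False t s by (intro mult_right_mono powr_mono2') auto
    finally show ?thesis using t by (simp add: add_increasing)
  qed
  have "sum p F \<le> t powr (1 - \<alpha>) * (\<Sum>a\<in>F. p a powr \<alpha>) + t powr (1 - s) * (\<Sum>a\<in>F. p a powr s)"
    unfolding sum_distrib_left sum.distrib[symmetric] by (rule sum_mono) (rule le)
  also have "\<dots> \<le> t powr (1 - \<alpha>) * K + t powr (1 - s) * E"
    using K E t by (intro add_mono mult_left_mono) auto
  finally show ?thesis .
qed

lemma exp_diff_le:
  fixes x :: real
  assumes "0 \<le> x" "x \<le> 1"
  shows "exp x - 1 \<le> 2 * x"
proof -
  have "exp x \<le> 1 + x + x\<^sup>2" using exp_bound[of x] assms by simp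
  moreover have "x\<^sup>2 \<le> x" using assms by (simp add: power2_eq_square mult_left_le)
  ultimately show ?thesis by simp
qed

lemma theta_branch_iff:
  assumes h: "2 \<le> h" and \<alpha>: "0 < \<alpha>"
  shows "1 / (real h * \<alpha>) \<le> (1 - \<alpha>) / ((real h - 1) * \<alpha>) \<longleftrightarrow> \<alpha> \<le> 1 / real h"
    and "(1 - \<alpha>) / ((real h - 1) * \<alpha>) \<le> 1 / (real h * \<alpha>) \<longleftrightarrow> 1 / real h \<le> \<alpha>"
proof -
  have pos: "0 < real h * \<alpha>" "0 < (real h - 1) * \<alpha>" "0 < real h" using assms by auto
  have frac: "x / a \<le> y / b \<longleftrightarrow> x * b \<le> y * a" if "0 < a" "0 < b" for x y a b :: real
    using that by (simp add: field_simps)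
  have "1 / (real h * \<alpha>) \<le> (1 - \<alpha>) / ((real h - 1) * \<alpha>) \<longleftrightarrow> \<alpha> * (real h - 1) \<le> \<alpha> * ((1 - \<alpha>) * real h)"
    unfolding frac[OF pos(1,2)] by (simp add: algebra_simps)
  also have "\<dots> \<longleftrightarrow> \<alpha> \<le> 1 / real h" using \<alpha> pos by (simp add: pos_le_divide_eq algebra_simps)
  finally show "1 / (real h * \<alpha>) \<le> (1 - \<alpha>) / ((real h - 1) * \<alpha>) \<longleftrightarrow> \<alpha> \<le> 1 / real h" .
  have "(1 - \<alpha>) / ((real h - 1) * \<alpha>) \<le> 1 / (real h * \<alpha>) \<longleftrightarrow> \<alpha> * ((1 - \<alpha>) * real h) \<le> \<alpha> * (real h - 1)"
    unfolding frac[OF pos(2,1)] by (simp add: algebra_simps)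
  also have "\<dots> \<longleftrightarrow> 1 / real h \<le> \<alpha>" using \<alpha> pos by (simp add: pos_divide_le_eq algebra_simps)
  finally show "(1 - \<alpha>) / ((real h - 1) * \<alpha>) \<le> 1 / (real h * \<alpha>) \<longleftrightarrow> 1 / real h \<le> \<alpha>" .
qed

text \<open>The rejected atoms have \<alpha>-sum at most \<open>K\<close> and (h*\<alpha>)-sum at
  most \<open>E0 * C\<close>. If h*\<alpha> \<le> 1, the second bound alone controls the mass;
  otherwise it says little about tiny atoms, and the first one is needed for them.\<close>

lemma Bh_defect_upper_less_1:
  assumes h: "2 \<le> h" and \<alpha>: "0 < \<alpha>" "\<alpha> < 1"
  obtains c where "0 < c"
    "\<And>C (G :: 'g monoid) X. 0 < C \<Longrightarrow> C \<le> 1 \<Longrightarrow> admissible \<alpha> \<alpha> D h C G X \<Longrightarrow> Bh_defect h G X \<le> c * C powr theta h \<alpha>"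
proof -
  define K where "K = exp ((1 - \<alpha>) * D)"
  \<comment> \<open>\<open>K ^ h\<close> bounds the power sum of U,
    \<open>2 * (1 - \<alpha>)\<close> linearises exp ((1 - \<alpha>) * C) - 1 for C \<le> 1, and the
    denominator is the gain of a single collision.\<close>
  define E0 where "E0 = K ^ h * (2 * (1 - \<alpha>)) / (1 - 2 powr (\<alpha> - 1))"
  have 2: "(2::real) powr (\<alpha> - 1) < 1"
    using powr_less_mono[of "\<alpha> - 1" 0 "2::real"] \<alpha> by simp
  have K0: "0 < K" by (simp add: K_def)
  have E0: "0 < E0" using K0 \<alpha> 2 by (simp add: E0_def)
  have bound: "Bh_defect h G X \<le> b"
    if C: "0 < C" "C \<le> 1" and adm: "admissible \<alpha> \<alpha> D h C G X"
      and b: "\<And>F. finite F \<Longrightarrow> F \<subseteq> set_pmf X \<Longrightarrow> (\<Sum>a\<in>F. pmf X a powr \<alpha>) \<le> K \<Longrightarrow>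
        (\<Sum>a\<in>F. pmf X a powr (real h * \<alpha>)) \<le> E0 * C \<Longrightarrow> sum (pmf X) F \<le> b"
    for C G X b
  proof -
    have "(1 - \<alpha>) * C \<le> 1" using mult_mono[of "1 - \<alpha>" 1 C 1] \<alpha> C by simp
    then have "exp ((1 - \<alpha>) * C) - 1 \<le> 2 * ((1 - \<alpha>) * C)" using C \<alpha> by (intro exp_diff_le) auto
    then have "K ^ h * (exp ((1 - \<alpha>) * C) - 1) \<le> K ^ h * (2 * ((1 - \<alpha>) * C))"
      using K0 by (intro mult_left_mono) auto
    then have E: "K ^ h * (exp ((1 - \<alpha>) * C) - 1) / (1 - 2 powr (\<alpha> - 1)) \<le> E0 * C"
      unfolding E0_def times_divide_eq_left using 2 by (intro divide_right_mono) (auto simp only: mult.assoc)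
    show ?thesis
    proof (rule admissible_power_sums[OF adm \<alpha>])
      fix B assume B: "B \<subseteq> set_pmf X" "Bh_set G h B"
        and "\<And>F. finite F \<Longrightarrow> F \<subseteq> set_pmf X - B \<Longrightarrow> (\<Sum>a\<in>F. pmf X a powr \<alpha>) \<le> exp ((1 - \<alpha>) * D)"
        and "\<And>F. finite F \<Longrightarrow> F \<subseteq> set_pmf X - B \<Longrightarrow> (\<Sum>a\<in>F. pmf X a powr (real h * \<alpha>))
         \<le> exp ((1 - \<alpha>) * D) ^ h * (exp ((1 - \<alpha>) * C) - 1) / (1 - 2 powr (\<alpha> - 1))"
      then show "Bh_defect h G X \<le> b"
        using E by (intro Bh_defect_le_finite_sums[OF B] b) (auto simp: K_def intro: order_trans)
    qed (use h in simp)
  qed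
  show thesis
  proof (cases "\<alpha> \<le> 1 / real h")
    case True
    then have th: "theta h \<alpha> = 1 / (real h * \<alpha>)"
      using theta_branch_iff[OF h \<alpha>(1)] by (simp add: theta_def)
    have True: "real h * \<alpha> \<le> 1" using True h by (simp add: field_simps)
    show thesis
    proof (rule that[of "E0 powr theta h \<alpha>"])
      fix C G X assume C: "0 < C" "C \<le> 1" and adm: "admissible \<alpha> \<alpha> D h C (G :: 'g monoid) X"
      have "Bh_defect h G X \<le> (E0 * C) powr (1 / (real h * \<alpha>))"
        by (rule bound[OF C adm], rule sum_le_powr_of_sum_powr_le)
          (use True \<alpha> h in \<open>auto intro: pmf_positive\<close>)
      then show "Bh_defect h G X \<le> E0 powr theta h \<alpha> * C powr theta h \<alpha>"
        using C E0 by (simp add: th powr_mult)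
    qed (use E0 in simp)
  next
    case False
    define \<theta> where "\<theta> = (1 - \<alpha>) / ((real h - 1) * \<alpha>)"
    have th: "theta h \<alpha> = \<theta>"
      using False theta_branch_iff[OF h \<alpha>(1)] by (simp add: theta_def \<theta>_def)
    have False: "1 \<le> real h * \<alpha>" using False h by (simp add: field_simps)
    show thesis
    proof (rule that[of "K + E0"])
      fix C G X assume C: "0 < C" "C \<le> 1" and adm: "admissible \<alpha> \<alpha> D h C (G :: 'g monoid) X"
      \<comment> \<open>The balance t^(1 - \<alpha>) = t^(1 - h*\<alpha>) * C, that is t^((h -
        1)*\<alpha>) = C; both terms become C^\<theta>.\<close>
      define t where "t = C powr (1 / ((real h - 1) * \<alpha>))"
      have t: "0 < t" using C by (simp add: t_def)
      have t1: "t powr (1 - \<alpha>) = C powr \<theta>" by (simp add: t_def powr_powr \<theta>_def)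
      have "t powr (1 - real h * \<alpha>) * C = C powr ((1 - real h * \<alpha>) / ((real h - 1) * \<alpha>) + 1)"
        using C by (simp add: t_def powr_powr powr_add)
      also have "(1 - real h * \<alpha>) / ((real h - 1) * \<alpha>) + 1 = \<theta>"
        using h \<alpha> by (simp add: \<theta>_def field_simps)
      finally have t2: "t powr (1 - real h * \<alpha>) * C = C powr \<theta>" .
      have "Bh_defect h G X \<le> t powr (1 - \<alpha>) * K + t powr (1 - real h * \<alpha>) * (E0 * C)"
        by (rule bound[OF C adm], rule sum_le_threshold)
          (use False \<alpha> h t in \<open>auto intro: pmf_positive\<close>)
      also have "\<dots> = C powr \<theta> * K + E0 * (t powr (1 - real h * \<alpha>) * C)"
        unfolding t1 by simp
      also have "\<dots> = (K + E0) * C powr theta h \<alpha>"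
        unfolding t2 by (simp add: th algebra_simps)
      finally show "Bh_defect h G X \<le> (K + E0) * C powr theta h \<alpha>" .
    qed (use E0 K0 in simp)
  qed
qed

text \<open>For rejected atoms of total mass x, averaging exp ((h - 1) * ln p) with weights p / x
  gives, by convexity, a sum of p^h of at least x * exp (- (h - 1) * D / x). This increases with x,
  while the gap bounds ln 2 times the sum by \<open>C\<close>; the hypothesis on \<open>C\<close>
  excludes x > d.\<close>

lemma Bh_defect_upper_1:
  assumes h: "2 \<le> h" and adm: "admissible 1 1 D h C G X" and D: "0 < D" and d: "0 < d"
    and C: "C < ln 2 * (d * exp (- ((real h - 1) * D / d)))"
  shows "Bh_defect h G X \<le> d"
proof -
  let ?U = "U_law h X" and ?S = "S_law G h X"
  have G: "comm_group G" and X: "set_pmf X \<subseteq> carrier G"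
    and gap: "enn2ereal (shannon_entropy ?U) - enn2ereal (shannon_entropy ?S) \<le> ereal C"
    and DX: "enn2ereal (shannon_entropy X) \<le> ereal D"
    using adm by (auto simp: admissible_def entropy_gap_def renyi_entropy_def)
  have h0: "0 < h" using h by simp
  obtain B where B: "B \<subseteq> set_pmf X" "Bh_set G h B" and sums:
    "\<And>F. finite F \<Longrightarrow> F \<subseteq> set_pmf X - B \<Longrightarrow>
       shannon_entropy ?S + ennreal (\<Sum>a\<in>F. ln 2 * pmf X a ^ h) \<le> shannon_entropy ?U"
    using Bh_subset_gap[OF G X h0] by metis
  have fU: "shannon_entropy ?U \<noteq> \<infinity>" using gap by auto
  then have fS: "shannon_entropy ?S \<noteq> \<infinity>" using sums[of "{}"] by (auto simp: top_unique)
  define HU HS where "HU = enn2real (shannon_entropy ?U)" "HS = enn2real (shannon_entropy ?S)"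
  have H: "shannon_entropy ?U = ennreal HU" "shannon_entropy ?S = ennreal HS" "0 \<le> HU" "0 \<le> HS"
    using fU fS by (auto simp: HU_HS_def less_top)
  have HC: "HU - HS \<le> C" using gap H by (simp add: enn2ereal_ennreal)
  show ?thesis
  proof (rule Bh_defect_le_finite_sums[OF B])
    fix F assume F: "finite F" "F \<subseteq> set_pmf X - B"
    let ?x = "sum (pmf X) F"
    have "ennreal HS + ennreal (\<Sum>a\<in>F. ln 2 * pmf X a ^ h) \<le> ennreal HU" using sums[OF F] H by simp
    then have "(\<Sum>a\<in>F. ln 2 * pmf X a ^ h) \<le> HU - HS"
      using H by (simp add: ennreal_plus[symmetric] sum_nonneg del: ennreal_plus)
    then have hC: "ln 2 * (\<Sum>a\<in>F. pmf X a ^ h) \<le> C" using HC by (simp add: sum_distrib_left)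
    have "enn2ereal (ennreal (\<Sum>a\<in>F. - (pmf X a * ln (pmf X a)))) \<le> ereal D"
      using sum_pmf_le_shannon_entropy[OF F(1), of X] DX by (metis less_eq_ennreal.rep_eq order_trans)
    then have ent: "(\<Sum>a\<in>F. - (pmf X a * ln (pmf X a))) \<le> D"
      using D by (cases "0 \<le> (\<Sum>a\<in>F. - (pmf X a * ln (pmf X a)))") (auto simp: enn2ereal_ennreal)
    show "?x \<le> d"
    proof (rule ccontr)
      assume "\<not> ?x \<le> d"
      then have x: "d < ?x" "0 < ?x" using d by auto
      \<comment> \<open>An upper bound for the mean of - ln p over \<open>F\<close> with weights p /
        ?x, used as the point of tangency.\<close>
      define l where "l = D / ?x"
      have "d * exp (- ((real h - 1) * D / d)) \<le> ?x * exp (- ((real h - 1) * l))"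
        using x d h D by (intro mult_mono) (auto simp: l_def intro!: divide_left_mono)
      \<comment> \<open>the tangent of \<open>\<lambda>L. exp (- (h - 1) * L)\<close> at \<open>l\<close> lies below the graph\<close>
      also have "\<dots> \<le> (\<Sum>a\<in>F. pmf X a ^ h)"
      proof -
        have tangent: "exp (- ((real h - 1) * l)) * (pmf X a * (1 + (real h - 1) * l) + (real h - 1) * (pmf X a * ln (pmf X a)))
            \<le> pmf X a ^ h" if "a \<in> F" for a
        proof -
          have p: "0 < pmf X a" using that F by (auto intro: pmf_positive)
          have "1 + ((real h - 1) * l + (real h - 1) * ln (pmf X a)) \<le> exp ((real h - 1) * l + (real h - 1) * ln (pmf X a))"
            by (rule exp_ge_add_one_self)
          then have "exp (- ((real h - 1) * l)) * pmf X a * (1 + ((real h - 1) * l + (real h - 1) * ln (pmf X a)))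
            \<le> exp (- ((real h - 1) * l)) * pmf X a * exp ((real h - 1) * l + (real h - 1) * ln (pmf X a))"
            using p by (intro mult_left_mono) auto
          also have "\<dots> = pmf X a * exp ((real h - 1) * ln (pmf X a))" by (simp add: exp_add exp_minus)
          also have "exp ((real h - 1) * ln (pmf X a)) = pmf X a ^ (h - 1)"
            using exp_of_nat_mult[of "h - 1" "ln (pmf X a)"] h p by (simp add: of_nat_diff)
          also have "pmf X a * pmf X a ^ (h - 1) = pmf X a ^ h" using h by (simp add: power_eq_if)
          finally show ?thesis by (simp add: algebra_simps)
        qed
        have "?x * (1 + (real h - 1) * l) + (real h - 1) * (\<Sum>a\<in>F. pmf X a * ln (pmf X a)) \<ge> ?x"
        proof -
          have "(real h - 1) * (- (\<Sum>a\<in>F. pmf X a * ln (pmf X a))) \<le> (real h - 1) * D"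
            using ent h by (intro mult_left_mono) (auto simp: sum_negf)
          moreover have "?x * ((real h - 1) * l) = (real h - 1) * D" using x by (simp add: l_def)
          ultimately show ?thesis by (simp add: algebra_simps)
        qed
        then have "?x * exp (- ((real h - 1) * l)) \<le> exp (- ((real h - 1) * l)) *
            (?x * (1 + (real h - 1) * l) + (real h - 1) * (\<Sum>a\<in>F. pmf X a * ln (pmf X a)))"
          by (simp add: mult.commute)
        also have "\<dots> = (\<Sum>a\<in>F. exp (- ((real h - 1) * l)) *
            (pmf X a * (1 + (real h - 1) * l) + (real h - 1) * (pmf X a * ln (pmf X a))))"
          by (simp add: sum_distrib_left[symmetric] sum_distrib_right[symmetric] sum.distrib)
        also have "\<dots> \<le> (\<Sum>a\<in>F. pmf X a ^ h)" by (rule sum_mono) (rule tangent)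
        finally show ?thesis .
      qed
      finally have "ln 2 * (d * exp (- ((real h - 1) * D / d))) \<le> ln 2 * (\<Sum>a\<in>F. pmf X a ^ h)"
        by (rule mult_left_mono) simp
      then show False using hC C by linarith
    qed
  qed
qed

text \<open>The collision of one rejected atom alone forces that atom below \<open>t\<close>, which
  is small with \<open>C\<close>. In the power sum of \<open>X\<close>, written as the mean of
  p^(\<alpha> - 1), atoms of \<open>B\<close> are at most the mass of \<open>B\<close> and all
  others at most \<open>t\<close>. As the entropy bound keeps this power sum away from 0, the mass
  of \<open>B\<close> must be large.\<close>

lemma Bh_defect_upper_greater_1:
  assumes h: "2 \<le> h" and adm: "admissible \<alpha> \<alpha> D h C G X" and \<alpha>: "1 < \<alpha>" and C: "0 \<le> C"
  defines "t \<equiv> ((exp ((\<alpha> - 1) * C) - 1) / (2 powr (\<alpha> - 1) - 1)) powr (1 / (real h * \<alpha>))"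
  assumes t: "t powr (\<alpha> - 1) \<le> exp (- ((\<alpha> - 1) * D))"
  shows "Bh_defect h G X \<le> 1 - (exp (- ((\<alpha> - 1) * D)) - t powr (\<alpha> - 1)) powr (1 / \<alpha>)"
proof -
  let ?U = "U_law h X" and ?S = "S_law G h X"
  have G: "comm_group G" and X: "set_pmf X \<subseteq> carrier G"
    and gap: "renyi_entropy \<alpha> ?U - renyi_entropy \<alpha> ?S \<le> ereal C" and D: "renyi_entropy \<alpha> X \<le> ereal D"
    using adm by (auto simp: admissible_def entropy_gap_def)
  have h0: "0 < h" using h by simp
  obtain B where B: "B \<subseteq> set_pmf X" "Bh_set G h B" and sums:
    "\<And>F. finite F \<Longrightarrow> F \<subseteq> set_pmf X - B \<Longrightarrow>
       power_sum \<alpha> ?U + ennreal (\<Sum>a\<in>F. (2 powr (\<alpha> - 1) - 1) * pmf X a powr (real h * \<alpha>)) \<le> power_sum \<alpha> ?S"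
    using Bh_subset_gap[OF G X h0] \<alpha> by metis
  have fin: "power_sum \<alpha> X \<noteq> \<infinity>" "power_sum \<alpha> ?U \<noteq> \<infinity>" "power_sum \<alpha> ?S \<noteq> \<infinity>"
    using power_sum_le_1[of \<alpha> X] power_sum_le_1[of \<alpha> ?U] power_sum_le_1[of \<alpha> ?S] \<alpha>
    by (auto simp: top_unique)
  define MX MU MS where "MX = enn2real (power_sum \<alpha> X)" "MU = enn2real (power_sum \<alpha> ?U)" "MS = enn2real (power_sum \<alpha> ?S)"
  have ps: "power_sum \<alpha> X = ennreal MX" "power_sum \<alpha> ?U = ennreal MU" "power_sum \<alpha> ?S = ennreal MS"
    using fin by (auto simp: MX_MU_MS_def less_top)
  have pos: "0 < MX" "0 < MU" "0 < MS"
    using fin enn2real_power_sum_pos by (auto simp: MX_MU_MS_def)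
  have MU1: "MU \<le> 1" using power_sum_le_1[of \<alpha> ?U] \<alpha> ps by simp
  have "ln MX / (1 - \<alpha>) \<le> D" using D \<alpha> fin by (simp add: renyi_entropy_def MX_MU_MS_def)
  then have "- ((\<alpha> - 1) * D) \<le> ln MX" using \<alpha> by (simp add: neg_divide_le_eq algebra_simps)
  then have MX: "exp (- ((\<alpha> - 1) * D)) \<le> MX" using pos by (simp add: ln_ge_iff)
  have "ln MU / (1 - \<alpha>) - ln MS / (1 - \<alpha>) \<le> C"
    using gap \<alpha> fin by (simp add: renyi_entropy_def MX_MU_MS_def)
  then have "ln MS \<le> ln MU + (\<alpha> - 1) * C"
    using \<alpha> by (simp add: diff_divide_distrib[symmetric] neg_divide_le_eq algebra_simps)
  then have "exp (ln MS) \<le> exp (ln MU + (\<alpha> - 1) * C)" by simp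
  then have MS: "MS \<le> MU * exp ((\<alpha> - 1) * C)" using pos by (simp add: exp_add)
  have e: "1 \<le> exp ((\<alpha> - 1) * C)" using \<alpha> C by simp
  have "MS - MU \<le> MU * (exp ((\<alpha> - 1) * C) - 1)" using MS by (simp add: algebra_simps)
  also have "\<dots> \<le> exp ((\<alpha> - 1) * C) - 1" using MU1 pos e by (simp add: mult_left_le_one_le)
  finally have MSU: "MS - MU \<le> exp ((\<alpha> - 1) * C) - 1" .
  have 2: "1 < (2::real) powr (\<alpha> - 1)"
    using powr_less_mono[of 0 "\<alpha> - 1" "2::real"] \<alpha> by simp
  have small: "pmf X a \<le> t" if "a \<in> set_pmf X - B" for a
  proof -
    have "ennreal MU + ennreal ((2 powr (\<alpha> - 1) - 1) * pmf X a powr (real h * \<alpha>)) \<le> ennreal MS"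
      using sums[of "{a}"] that ps by simp
    then have "(2 powr (\<alpha> - 1) - 1) * pmf X a powr (real h * \<alpha>) \<le> MS - MU"
      using pos 2 by (simp add: ennreal_plus[symmetric] del: ennreal_plus)
    then have "pmf X a powr (real h * \<alpha>) \<le> (exp ((\<alpha> - 1) * C) - 1) / (2 powr (\<alpha> - 1) - 1)"
      using MSU 2 by (simp add: pos_le_divide_eq mult.commute)
    then have "(pmf X a powr (real h * \<alpha>)) powr (1 / (real h * \<alpha>)) \<le> t"
      unfolding t_def using h \<alpha> by (intro powr_mono2) auto
    then show ?thesis using h \<alpha> by (simp add: powr_powr)
  qed
  let ?m = "measure_pmf.prob X B"
  have "ennreal MX = (\<integral>\<^sup>+x. ennreal (pmf X x powr (\<alpha> - 1)) \<partial>X)"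
    using ps by (simp add: power_sum_eq_nn_integral)
  also have "\<dots> \<le> (\<integral>\<^sup>+x. ennreal (?m powr (\<alpha> - 1)) * indicator B x + ennreal (t powr (\<alpha> - 1)) \<partial>X)"
  proof (rule nn_integral_mono_AE, rule AE_pmfI)
    fix x assume x: "x \<in> set_pmf X"
    show "ennreal (pmf X x powr (\<alpha> - 1)) \<le> ennreal (?m powr (\<alpha> - 1)) * indicator B x + ennreal (t powr (\<alpha> - 1))"
    proof (cases "x \<in> B")
      case True
      then have "measure_pmf.prob X {x} \<le> ?m" by (intro measure_pmf.finite_measure_mono) auto
      then have "pmf X x powr (\<alpha> - 1) \<le> ?m powr (\<alpha> - 1)"
        using \<alpha> by (intro powr_mono2) (auto simp: measure_pmf_single)
      then show ?thesis using True by (simp add: add_increasing2 ennreal_leI)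
    next
      case False
      then show ?thesis using small[of x] x \<alpha> by (auto intro!: ennreal_leI powr_mono2)
    qed
  qed
  also have "\<dots> = ennreal (?m powr (\<alpha> - 1)) * ennreal ?m + ennreal (t powr (\<alpha> - 1))"
    by (simp add: nn_integral_add nn_integral_cmult measure_pmf.emeasure_eq_measure)
  also have "\<dots> = ennreal (?m powr \<alpha> + t powr (\<alpha> - 1))"
    by (cases "?m = 0") (auto simp: ennreal_mult[symmetric] ennreal_plus[symmetric] powr_diff zero_less_measure_iff simp del: ennreal_plus)
  finally have "MX \<le> ?m powr \<alpha> + t powr (\<alpha> - 1)" by (subst (asm) ennreal_le_iff) auto
  then have "exp (- ((\<alpha> - 1) * D)) - t powr (\<alpha> - 1) \<le> ?m powr \<alpha>" using MX by simp
  then have "(exp (- ((\<alpha> - 1) * D)) - t powr (\<alpha> - 1)) powr (1 / \<alpha>) \<le> (?m powr \<alpha>) powr (1 / \<alpha>)"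
    using t \<alpha> by (intro powr_mono2) auto
  then show ?thesis using Bh_defect_le_prob[OF B] \<alpha> by (simp add: powr_powr)
qed

subsection \<open>Admissible laws with large defect\<close>

text \<open>All entropies of a constant law vanish. This makes the set of defects nonempty, without
  which a bound on its members would not bound the real-valued \<open>Sup\<close>.\<close>

lemma admissible_return_pmf:
  assumes h: "2 \<le> h" and "0 \<le> C" "0 \<le> D"
  shows "admissible \<alpha> \<beta> D h C (cyclic_power h) (return_pmf (vertex 0))"
proof -
  have ps: "power_sum a (return_pmf y) = 1" and se: "shannon_entropy (return_pmf y) = 0" for a and y :: 'z
    by (simp_all add: power_sum_eq_nn_integral shannon_entropy_eq_nn_integral)
  have H: "renyi_entropy a (return_pmf y) = 0" for a and y :: 'z
    by (simp add: renyi_entropy_def ps se zero_ereal_def zero_ennreal.rep_eq)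
  have rep: "replicate_pmf n (return_pmf y) = return_pmf (replicate n y)" for n and y :: 'z
    by (induction n) (simp_all add: bind_return_pmf)
  show ?thesis
    using assms vertex_carrier[OF h, of 0] comm_group_cyclic_power[of h]
    by (auto simp: admissible_def finite_entropy_cond_def entropy_gap_def U_law_def S_law_def rep ps H)
qed

lemma Phi_le:
  assumes "2 \<le> h" "0 \<le> C" "0 \<le> D"
    and le: "\<And>(G :: 'g::infinite monoid) X. admissible \<alpha> \<beta> D h C G X \<Longrightarrow> Bh_defect h G X \<le> b"
  shows "Phi TYPE('g) \<alpha> \<beta> D h C \<le> b"
  unfolding Phi_def
proof (rule cSup_least)
  show "{Bh_defect h G X | (G :: 'g monoid) X. admissible \<alpha> \<beta> D h C G X} \<noteq> {}"
    using transfer_admissible[where 'g = 'g, OF admissible_return_pmf[OF assms(1-3), of \<alpha> \<beta>]] by blast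
qed (use le in auto)

section \<open>Conditions under which the spike laws are admissible\<close>

lemma power_sum_ge_1:
  assumes "\<alpha> \<le> 1"
  shows "1 \<le> power_sum \<alpha> Y"
proof -
  have "1 \<le> pmf Y y powr (\<alpha> - 1)" if "y \<in> set_pmf Y" for y
    using powr_mono2'[of "\<alpha> - 1" "pmf Y y" 1] assms pmf_positive[OF that] by (simp add: pmf_le_1)
  then have "(\<integral>\<^sup>+y. 1 \<partial>Y) \<le> power_sum \<alpha> Y"
    unfolding power_sum_eq_nn_integral by (intro nn_integral_mono_AE AE_pmfI) simp
  then show ?thesis by simp
qed

lemma ln_add_le:
  fixes x y :: real
  assumes "0 < x" "0 \<le> y"
  shows "ln (x + y) \<le> ln x + y / x"
proof -
  have "x + y = x * (1 + y / x)" using assms by (simp add: field_simps)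
  then have "ln (x + y) = ln x + ln (1 + y / x)"
    using ln_mult_pos[of x "1 + y / x"] assms by (simp add: add_pos_nonneg)
  then show ?thesis using ln_add_one_self_le_self[of "y / x"] assms by simp
qed

text \<open>The heavy atom contributes at most 1 to the power sum, hence the \<open>- 1\<close> in
  the entropy condition. Merging does not decrease the term of the neutral element, so U exceeds S
  by at most the terms of the constant light multisets; since the power sum of S is at least 1, the
  logarithms differ by no more.\<close>

lemma spike_le_Phi_less_1:
  assumes h: "2 \<le> h" and \<alpha>: "0 < \<alpha>" "\<alpha> < 1" and N: "0 < N" and d: "0 < d" "d < 1" "d / real N \<le> 1 - d"
    and D: "real N * (d / real N) powr \<alpha> \<le> exp ((1 - \<alpha>) * D) - 1"
    and C: "real N * (d / real N) powr (real h * \<alpha>) \<le> (1 - \<alpha>) * C"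
  shows "d \<le> Phi TYPE('g::infinite) \<alpha> \<alpha> D h C"
proof (rule spike_pmf[OF h N d])
  fix G :: "(nat \<Rightarrow> nat) monoid" and X
  assume G: "comm_group G" "set_pmf X \<subseteq> carrier G" and defect: "d \<le> Bh_defect h G X"
    and sX: "\<And>g :: real \<Rightarrow> real. g 0 = 0 \<Longrightarrow> (\<And>x. 0 \<le> x \<Longrightarrow> x \<le> 1 \<Longrightarrow> 0 \<le> g x) \<Longrightarrow>
       (\<Sum>\<^sub>\<infinity>x. ennreal (g (pmf X x))) = ennreal (g (1 - d) + real N * g (d / real N))"
    and sU: "\<And>g :: real \<Rightarrow> real. g 0 = 0 \<Longrightarrow> (\<And>x. 0 \<le> x \<Longrightarrow> x \<le> 1 \<Longrightarrow> 0 \<le> g x) \<Longrightarrow>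
       \<exists>R\<ge>0. (\<Sum>\<^sub>\<infinity>u. ennreal (g (pmf (U_law h X) u)))
             = ennreal (R + g ((1 - d) ^ h) + real N * g ((d / real N) ^ h)) \<and>
           (\<Sum>\<^sub>\<infinity>s. ennreal (g (pmf (S_law G h X) s)))
             = ennreal (R + g ((1 - d) ^ h + real N * (d / real N) ^ h))"
  define m where "m = d / real N"
  have m: "0 < m" using N d by (simp add: m_def)
  define MX where "MX = (1 - d) powr \<alpha> + real N * m powr \<alpha>"
  have psX: "power_sum \<alpha> X = ennreal MX"
    using sX[of "\<lambda>x. x powr \<alpha>"] by (simp add: power_sum_def MX_def m_def)
  obtain R where R: "0 \<le> R"
    "power_sum \<alpha> (U_law h X) = ennreal (R + ((1 - d) ^ h) powr \<alpha> + real N * (m ^ h) powr \<alpha>)"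
    "power_sum \<alpha> (S_law G h X) = ennreal (R + ((1 - d) ^ h + real N * m ^ h) powr \<alpha>)"
    using sU[of "\<lambda>x. x powr \<alpha>"] by (auto simp: power_sum_def m_def)
  define MU MS where "MU = R + ((1 - d) ^ h) powr \<alpha> + real N * (m ^ h) powr \<alpha>"
    and "MS = R + ((1 - d) ^ h + real N * m ^ h) powr \<alpha>"
  have psU: "power_sum \<alpha> (U_law h X) = ennreal MU" "power_sum \<alpha> (S_law G h X) = ennreal MS"
    using R by (simp_all only: MU_def MS_def)
  have MS: "1 \<le> MS" using power_sum_ge_1[of \<alpha> "S_law G h X"] \<alpha> psU by simp
  have MU: "1 \<le> MU" using power_sum_ge_1[of \<alpha> "U_law h X"] \<alpha> psU by simp
  have MX1: "1 \<le> MX" using power_sum_ge_1[of \<alpha> X] \<alpha> psX by simp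
  have "(1 - d) powr \<alpha> \<le> 1" using d \<alpha> by (intro powr_le1) auto
  then have "MX \<le> exp ((1 - \<alpha>) * D)" using D by (simp add: MX_def m_def)
  then have "ln MX \<le> (1 - \<alpha>) * D" using ln_le_cancel_iff[of MX "exp ((1 - \<alpha>) * D)"] MX1 by simp
  then have HX: "renyi_entropy \<alpha> X \<le> ereal D"
    using \<alpha> MX1 psX by (simp add: renyi_entropy_def pos_divide_le_eq mult.commute)
  have "((1 - d) ^ h) powr \<alpha> \<le> ((1 - d) ^ h + real N * m ^ h) powr \<alpha>"
    using d \<alpha> m by (intro powr_mono2) auto
  moreover have "(m ^ h) powr \<alpha> = m powr (real h * \<alpha>)"
    using m by (simp add: powr_realpow[symmetric] powr_powr)
  ultimately have "MU \<le> MS + (1 - \<alpha>) * C" using C by (simp add: MU_def MS_def m_def)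
  moreover have C0: "0 \<le> (1 - \<alpha>) * C" using C by (rule order_trans[rotated]) simp
  ultimately have "ln MU \<le> ln (MS + (1 - \<alpha>) * C)" using MU by simp
  also have "\<dots> \<le> ln MS + (1 - \<alpha>) * C / MS" using MS C0 by (intro ln_add_le) auto
  also have "(1 - \<alpha>) * C / MS \<le> (1 - \<alpha>) * C"
    using divide_left_mono[of 1 MS "(1 - \<alpha>) * C"] MS C0 by simp
  finally have "(ln MU - ln MS) / (1 - \<alpha>) \<le> C" using \<alpha> by (simp add: pos_divide_le_eq mult.commute)
  then have "entropy_gap \<alpha> h G X \<le> ereal C"
    using \<alpha> psU MU MS by (simp add: entropy_gap_def renyi_entropy_def diff_divide_distrib)
  then have "admissible \<alpha> \<alpha> D h C G X"
    using G HX \<alpha> psU by (simp add: admissible_def finite_entropy_cond_def)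
  \<comment> \<open>The law lives on \<open>nat \<Rightarrow> nat\<close>; its defect is carried
    over to the arbitrary infinite type 'g.\<close>
  then show ?thesis using Bh_defect_le_Phi[where 'g = 'g] defect by (meson order_trans)
qed

lemma mult_ln_add_le:
  fixes a r :: real
  assumes "0 < a" "0 \<le> r" "a + r \<le> 1"
  shows "(a + r) * ln (a + r) \<le> a * ln a + r"
proof -
  have "a * ln (a + r) \<le> a * (ln a + r / a)" using assms by (intro mult_left_mono ln_add_le) auto
  moreover have "r * ln (a + r) \<le> 0" using assms by (intro mult_nonneg_nonpos) auto
  ultimately show ?thesis using assms by (simp add: algebra_simps)
qed

text \<open>In the gap condition the part with the logarithm is the entropy of the constant light
  multisets, and the summand 1 pays for the change of the term - x * ln x when their mass N * m^h is
  added to the neutral atom.\<close>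

lemma spike_le_Phi_1:
  assumes h: "2 \<le> h" and N: "0 < N" and d: "0 < d" "d < 1" "d / real N \<le> 1 - d"
    and D: "- ((1 - d) * ln (1 - d)) - d * ln (d / real N) \<le> D"
    and C: "real N * (d / real N) ^ h * (1 - real h * ln (d / real N)) \<le> C"
  shows "d \<le> Phi TYPE('g::infinite) 1 1 D h C"
proof (rule spike_pmf[OF h N d])
  fix G :: "(nat \<Rightarrow> nat) monoid" and X
  assume G: "comm_group G" "set_pmf X \<subseteq> carrier G" and defect: "d \<le> Bh_defect h G X"
    and sX: "\<And>g :: real \<Rightarrow> real. g 0 = 0 \<Longrightarrow> (\<And>x. 0 \<le> x \<Longrightarrow> x \<le> 1 \<Longrightarrow> 0 \<le> g x) \<Longrightarrow>
       (\<Sum>\<^sub>\<infinity>x. ennreal (g (pmf X x))) = ennreal (g (1 - d) + real N * g (d / real N))"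
    and sU: "\<And>g :: real \<Rightarrow> real. g 0 = 0 \<Longrightarrow> (\<And>x. 0 \<le> x \<Longrightarrow> x \<le> 1 \<Longrightarrow> 0 \<le> g x) \<Longrightarrow>
       \<exists>R\<ge>0. (\<Sum>\<^sub>\<infinity>u. ennreal (g (pmf (U_law h X) u)))
             = ennreal (R + g ((1 - d) ^ h) + real N * g ((d / real N) ^ h)) \<and>
           (\<Sum>\<^sub>\<infinity>s. ennreal (g (pmf (S_law G h X) s)))
             = ennreal (R + g ((1 - d) ^ h + real N * (d / real N) ^ h))"
  define m where "m = d / real N"
  have m: "0 < m" "real N * m = d" using N d by (simp_all add: m_def)
  have m1: "m < 1" using d by (simp add: m_def)
  define g :: "real \<Rightarrow> real" where "g x = - (x * ln x)" for x
  have g0: "g 0 = 0" by (simp add: g_def)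
  have g: "0 \<le> g x" if "0 \<le> x" "x \<le> 1" for x
    using that by (cases "x = 0") (simp_all add: g_def mult_le_0_iff)
  define a where "a = (1 - d) ^ h"
  have a: "0 < a" using d by (simp add: a_def)
  have sums: "shannon_entropy Z = (\<Sum>\<^sub>\<infinity>z. ennreal (g (pmf Z z)))" for Z :: "'z pmf"
    by (simp add: shannon_entropy_def g_def)
  have "g (1 - d) + real N * g (d / real N) \<le> D"
    using D N by (simp add: g_def)
  moreover have "0 \<le> g (1 - d) + real N * g (d / real N)"
    using g d m m1 by (simp add: m_def[symmetric])
  ultimately have HX: "renyi_entropy 1 X \<le> ereal D"
    using sX[of g, OF g0 g] by (simp add: renyi_entropy_def sums enn2ereal_ennreal)
  obtain R where R: "0 \<le> R"
    "(\<Sum>\<^sub>\<infinity>u. ennreal (g (pmf (U_law h X) u))) = ennreal (R + g a + real N * g (m ^ h))"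
    "(\<Sum>\<^sub>\<infinity>s. ennreal (g (pmf (S_law G h X) s))) = ennreal (R + g (a + real N * m ^ h))"
    using sU[of g, OF g0 g] unfolding m_def a_def by auto
  define HU HS where "HU = R + g a + real N * g (m ^ h)" and "HS = R + g (a + real N * m ^ h)"
  have H: "shannon_entropy (U_law h X) = ennreal HU" "shannon_entropy (S_law G h X) = ennreal HS"
    using R by (simp_all only: sums HU_def HS_def)
  have mh: "m ^ h \<le> m" "a \<le> 1 - d"
    using power_decreasing[of 1 h m] power_decreasing[of 1 h "1 - d"] h m m1 d by (simp_all add: a_def)
  have "a + real N * m ^ h \<le> (1 - d) + real N * m" using mh by (intro add_mono mult_left_mono) auto
  then have T1: "a + real N * m ^ h \<le> 1" using m by simp
  have "g a \<le> g (a + real N * m ^ h) + real N * m ^ h"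
    using mult_ln_add_le[of a "real N * m ^ h"] a m T1 by (simp add: g_def)
  moreover have "real N * m ^ h * (1 - real h * ln m) = real N * m ^ h + real N * g (m ^ h)"
    using m by (simp add: g_def ln_realpow algebra_simps)
  ultimately have "HU - HS \<le> C"
    using C by (simp add: m_def[symmetric] HU_def HS_def)
  moreover have "0 \<le> HU" "0 \<le> HS"
    using R(1) a m m1 T1 mh d g[of a] g[of "m ^ h"] g[of "a + real N * m ^ h"]
    by (simp_all add: HU_def HS_def)
  ultimately have "entropy_gap 1 h G X \<le> ereal C"
    using H by (simp add: entropy_gap_def renyi_entropy_def enn2ereal_ennreal)
  then have "admissible 1 1 D h C G X"
    using G HX le_less_trans[OF HX, of \<infinity>] by (simp add: admissible_def finite_entropy_cond_def)
  then show ?thesis using Bh_defect_le_Phi[where 'g = 'g] defect by (meson order_trans)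
qed

text \<open>The heavy atom alone secures the entropy bound. The power sum of U is at least the term
  of the multiset of \<open>h\<close> neutral elements, so its relative increase on passing to S is
  at most that of this one term.\<close>

lemma spike_le_Phi_greater_1:
  assumes h: "2 \<le> h" and \<alpha>: "1 < \<alpha>" and N: "0 < N" and d: "0 < d" "d < 1" "d / real N \<le> 1 - d"
    and D: "exp (- ((\<alpha> - 1) * D)) \<le> (1 - d) powr \<alpha>"
    and C: "(((1 - d) ^ h + real N * (d / real N) ^ h) powr \<alpha> - ((1 - d) ^ h) powr \<alpha>) / ((1 - d) ^ h) powr \<alpha>
      \<le> (\<alpha> - 1) * C"
  shows "d \<le> Phi TYPE('g::infinite) \<alpha> \<alpha> D h C"
proof (rule spike_pmf[OF h N d])
  fix G :: "(nat \<Rightarrow> nat) monoid" and X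
  assume G: "comm_group G" "set_pmf X \<subseteq> carrier G" and defect: "d \<le> Bh_defect h G X"
    and sX: "\<And>g :: real \<Rightarrow> real. g 0 = 0 \<Longrightarrow> (\<And>x. 0 \<le> x \<Longrightarrow> x \<le> 1 \<Longrightarrow> 0 \<le> g x) \<Longrightarrow>
       (\<Sum>\<^sub>\<infinity>x. ennreal (g (pmf X x))) = ennreal (g (1 - d) + real N * g (d / real N))"
    and sU: "\<And>g :: real \<Rightarrow> real. g 0 = 0 \<Longrightarrow> (\<And>x. 0 \<le> x \<Longrightarrow> x \<le> 1 \<Longrightarrow> 0 \<le> g x) \<Longrightarrow>
       \<exists>R\<ge>0. (\<Sum>\<^sub>\<infinity>u. ennreal (g (pmf (U_law h X) u)))
             = ennreal (R + g ((1 - d) ^ h) + real N * g ((d / real N) ^ h)) \<and>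
           (\<Sum>\<^sub>\<infinity>s. ennreal (g (pmf (S_law G h X) s)))
             = ennreal (R + g ((1 - d) ^ h + real N * (d / real N) ^ h))"
  define m where "m = d / real N"
  have m: "0 < m" using N d by (simp add: m_def)
  define MX where "MX = (1 - d) powr \<alpha> + real N * m powr \<alpha>"
  have psX: "power_sum \<alpha> X = ennreal MX"
    using sX[of "\<lambda>x. x powr \<alpha>"] by (simp add: power_sum_def MX_def m_def)
  define a where "a = ((1 - d) ^ h) powr \<alpha>"
  have a: "0 < a" using d by (simp add: a_def)
  obtain R where R: "0 \<le> R"
    "power_sum \<alpha> (U_law h X) = ennreal (R + a + real N * (m ^ h) powr \<alpha>)"
    "power_sum \<alpha> (S_law G h X) = ennreal (R + ((1 - d) ^ h + real N * m ^ h) powr \<alpha>)"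
    using sU[of "\<lambda>x. x powr \<alpha>"] by (auto simp: power_sum_def m_def a_def)
  define MU MS where "MU = R + a + real N * (m ^ h) powr \<alpha>"
    and "MS = R + ((1 - d) ^ h + real N * m ^ h) powr \<alpha>"
  have psU: "power_sum \<alpha> (U_law h X) = ennreal MU" "power_sum \<alpha> (S_law G h X) = ennreal MS"
    using R by (simp_all only: MU_def MS_def)
  define y where "y = ((1 - d) ^ h + real N * m ^ h) powr \<alpha> - a"
  have y: "0 \<le> y" using m d \<alpha> by (auto simp: y_def a_def intro!: powr_mono2)
  have MS0: "0 < MS" using R y a by (simp add: MS_def y_def)
  have MUa: "a \<le> MU" using R by (simp add: MU_def)
  have "MS \<le> MU + y" by (simp add: MU_def MS_def y_def)
  then have "ln MS \<le> ln (MU + y)" using MS0 by simp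
  also have "\<dots> \<le> ln MU + y / MU" using MUa a y by (intro ln_add_le) auto
  also have "y / MU \<le> y / a" using MUa a y by (intro divide_left_mono) auto
  also have "y / a \<le> (\<alpha> - 1) * C" using C by (simp add: y_def a_def m_def)
  finally have "(ln MS - ln MU) / (\<alpha> - 1) \<le> C" using \<alpha> by (simp add: pos_divide_le_eq mult.commute)
  moreover have "(ln MS - ln MU) / (\<alpha> - 1) = ln MU / (1 - \<alpha>) - ln MS / (1 - \<alpha>)"
    using minus_divide_divide[of "ln MS - ln MU" "\<alpha> - 1"] by (simp add: diff_divide_distrib)
  ultimately have "entropy_gap \<alpha> h G X \<le> ereal C"
    using \<alpha> psU MUa a MS0 by (simp add: entropy_gap_def renyi_entropy_def)
  moreover have "renyi_entropy \<alpha> X \<le> ereal D"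
  proof -
    have MX: "exp (- ((\<alpha> - 1) * D)) \<le> MX" using D by (simp add: MX_def add_increasing2)
    then have "0 < MX" by (rule less_le_trans[rotated]) simp
    then have "- ((\<alpha> - 1) * D) \<le> ln MX" using MX by (simp add: ln_ge_iff)
    then have "ln MX / (1 - \<alpha>) \<le> D" using \<alpha> by (simp add: neg_divide_le_eq algebra_simps)
    then show ?thesis using \<alpha> psX \<open>0 < MX\<close> by (simp add: renyi_entropy_def)
  qed
  ultimately have "admissible \<alpha> \<alpha> D h C G X"
    using G \<alpha> psU by (simp add: admissible_def finite_entropy_cond_def)
  then show ?thesis using Bh_defect_le_Phi[where 'g = 'g] defect by (meson order_trans)
qed

subsection \<open>Asymptotics\<close>

lemma nat_floor_bounds:
  fixes y :: real
  assumes "2 \<le> y"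
  shows "0 < nat \<lfloor>y\<rfloor>" "real (nat \<lfloor>y\<rfloor>) \<le> y" "y / 2 \<le> real (nat \<lfloor>y\<rfloor>)"
  using assms by linarith+

lemma Phi_lower_less_1:
  assumes h: "2 \<le> h" and D: "0 < D" and \<alpha>: "0 < \<alpha>" "\<alpha> < 1"
  obtains c where "0 < c"
    "eventually (\<lambda>C. c * C powr theta h \<alpha> \<le> Phi TYPE('g::infinite) \<alpha> \<alpha> D h C) (at_right 0)"
proof (cases "\<alpha> \<le> 1 / real h")
  case True
  then have th: "theta h \<alpha> = 1 / (real h * \<alpha>)"
    using theta_branch_iff[OF h \<alpha>(1)] by (simp add: theta_def)
  define s where "s = 1 / (real h * \<alpha>)"
  have s: "0 < s" "s * (real h * \<alpha>) = 1" using h \<alpha> by (auto simp: s_def)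
  define k where "k = exp ((1 - \<alpha>) * D) - 1"
  have k: "0 < k" using D \<alpha> by (simp add: k_def)
  define b where "b = 1 - \<alpha>"
  have b: "0 < b" using \<alpha> by (simp add: b_def)
  have sa: "0 < s * \<alpha>" using s \<alpha> by simp
  have "((\<lambda>C. (b * C) powr s) \<longlongrightarrow> 0) (at_right 0)" using s(1) b by real_asymp
  then have 1: "eventually (\<lambda>C. (b * C) powr s < 1 / 2) (at_right 0)" by (rule order_tendstoD) simp
  have "((\<lambda>C. (b * C) powr (s * \<alpha>)) \<longlongrightarrow> 0) (at_right 0)" using sa b by real_asymp
  then have 2: "eventually (\<lambda>C. (b * C) powr (s * \<alpha>) < k) (at_right 0)" by (rule order_tendstoD) (rule k)
  have pos: "eventually (\<lambda>C::real. 0 < C) (at_right 0)" by (rule eventually_at_right_less)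
  show thesis
  proof (rule that[of "b powr s"])
    show "\<forall>\<^sub>F C in at_right 0. b powr s * C powr theta h \<alpha> \<le> Phi TYPE('g) \<alpha> \<alpha> D h C"
      using 1 2 pos
    proof eventually_elim
      case (elim C)
      \<comment> \<open>With one light atom the gap condition is an equality: d^(h*\<alpha>) = (1 -
        \<alpha>) * C.\<close>
      define d where "d = (b * C) powr s"
      have "d \<le> Phi TYPE('g) \<alpha> \<alpha> D h C"
      proof (rule spike_le_Phi_less_1[OF h \<alpha>, of 1])
        show "0 < d" "d < 1" "d / real 1 \<le> 1 - d" using elim b by (auto simp: d_def)
        show "real 1 * (d / real 1) powr \<alpha> \<le> exp ((1 - \<alpha>) * D) - 1"
          using elim(2) by (simp add: d_def powr_powr k_def)
        show "real 1 * (d / real 1) powr (real h * \<alpha>) \<le> (1 - \<alpha>) * C"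
          using s b elim by (simp add: d_def powr_powr b_def)
      qed simp
      then show ?case using b elim by (simp add: d_def powr_mult th s_def)
    qed
  qed (use b in simp)
next
  case False
  define \<theta> where "\<theta> = (1 - \<alpha>) / ((real h - 1) * \<alpha>)"
  have th: "theta h \<alpha> = \<theta>"
    using False theta_branch_iff[OF h \<alpha>(1)] by (simp add: theta_def \<theta>_def)
  define k where "k = exp ((1 - \<alpha>) * D) - 1"
  have k: "0 < k" using D \<alpha> by (simp add: k_def)
  define s where "s = 1 / ((real h - 1) * \<alpha>)"
  have s: "0 < s" "s * ((real h - 1) * \<alpha>) = 1" using h \<alpha> by (auto simp: s_def)
  define b where "b = (1 - \<alpha>) / k"
  have b: "0 < b" "k * b = 1 - \<alpha>" using \<alpha> k by (auto simp: b_def)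
  have sa: "0 < s * \<alpha>" "0 < s * (1 - \<alpha>)" using s \<alpha> by auto
  have "((\<lambda>C. (b * C) powr s) \<longlongrightarrow> 0) (at_right 0)" using s(1) b(1) by real_asymp
  then have 1: "eventually (\<lambda>C. (b * C) powr s < 1 / 2) (at_right 0)" by (rule order_tendstoD) simp
  have "((\<lambda>C. (b * C) powr (s * \<alpha>)) \<longlongrightarrow> 0) (at_right 0)" using sa(1) b(1) by real_asymp
  then have 2: "eventually (\<lambda>C. (b * C) powr (s * \<alpha>) < k / 2) (at_right 0)"
    by (rule order_tendstoD) (use k in simp)
  have "((\<lambda>C. k * (b * C) powr (s * (1 - \<alpha>))) \<longlongrightarrow> 0) (at_right 0)"
  proof -
    define e where "e = s * (1 - \<alpha>)"
    have "((\<lambda>C. k * (b * C) powr e) \<longlongrightarrow> 0) (at_right 0)" using sa(2)[folded e_def] b(1) by real_asymp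
    then show ?thesis by (simp add: e_def)
  qed
  then have 3: "eventually (\<lambda>C. k * (b * C) powr (s * (1 - \<alpha>)) < 1 / 2) (at_right 0)"
    by (rule order_tendstoD) simp
  have pos: "eventually (\<lambda>C::real. 0 < C) (at_right 0)" by (rule eventually_at_right_less)
  show thesis
  proof (rule that[of "k / 2 * b powr \<theta>"])
    show "\<forall>\<^sub>F C in at_right 0. k / 2 * b powr \<theta> * C powr theta h \<alpha> \<le> Phi TYPE('g) \<alpha> \<alpha> D h C"
      using 1 2 3 pos
    proof eventually_elim
      case (elim C)
      \<comment> \<open>The solution of k * m^((h - 1)*\<alpha>) = (1 - \<alpha>) * C, which is the
        gap condition for N = k * m^(-\<alpha>).\<close>
      define m where "m = (b * C) powr s"
      have m: "0 < m" "m < 1 / 2" "m powr \<alpha> < k / 2" "k * m powr (1 - \<alpha>) < 1 / 2"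
        using elim b by (auto simp: m_def powr_powr)
      \<comment> \<open>As many atoms of mass \<open>m\<close> as the entropy condition N *
        m^\<alpha> \<le> k allows. Rounding down costs at most a factor 2, so \<open>d\<close> is
        still of order m^(1 - \<alpha>).\<close>
      define N where "N = nat \<lfloor>k * m powr (- \<alpha>)\<rfloor>"
      have "2 \<le> k * m powr (- \<alpha>)" using m by (simp add: powr_minus field_simps)
      then have N: "0 < N" "real N \<le> k * m powr (- \<alpha>)" "k * m powr (- \<alpha>) / 2 \<le> real N"
        unfolding N_def by (rule nat_floor_bounds)+
      have m1: "m powr (- \<alpha>) * m = m powr (1 - \<alpha>)" using m by (simp add: powr_diff powr_minus field_simps)
      define d where "d = real N * m"
      have dm: "d / real N = m" using N by (simp add: d_def)
      have "d \<le> k * m powr (- \<alpha>) * m" unfolding d_def using N m by (intro mult_right_mono) auto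
      then have d2: "d < 1 / 2" using m m1 by (simp add: mult.assoc)
      have "k * m powr (- \<alpha>) / 2 * m \<le> d" unfolding d_def using N m by (intro mult_right_mono) auto
      then have d3: "k / 2 * m powr (1 - \<alpha>) \<le> d" using m1 by (simp add: mult.assoc)
      have "d \<le> Phi TYPE('g) \<alpha> \<alpha> D h C"
      proof (rule spike_le_Phi_less_1[OF h \<alpha> N(1)])
        show "0 < d" "d < 1" "d / real N \<le> 1 - d" using N m d2 unfolding dm by (auto simp: d_def)
        have "real N * m powr \<alpha> \<le> k * m powr (- \<alpha>) * m powr \<alpha>" using N by (intro mult_right_mono) auto
        then show "real N * (d / real N) powr \<alpha> \<le> exp ((1 - \<alpha>) * D) - 1"
          unfolding dm k_def[symmetric] using m by (simp add: mult.assoc powr_add[symmetric])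
        have "real N * m powr (real h * \<alpha>) \<le> k * m powr (- \<alpha>) * m powr (real h * \<alpha>)"
          using N by (intro mult_right_mono) auto
        also have "\<dots> = k * m powr ((real h - 1) * \<alpha>)"
          by (simp add: powr_add[symmetric] algebra_simps)
        also have "\<dots> = (1 - \<alpha>) * C"
          using s b elim by (simp add: m_def powr_powr)
        finally show "real N * (d / real N) powr (real h * \<alpha>) \<le> (1 - \<alpha>) * C" unfolding dm .
      qed
      moreover have "m powr (1 - \<alpha>) = b powr \<theta> * C powr \<theta>"
        using b elim by (simp add: m_def powr_powr powr_mult s_def \<theta>_def)
      ultimately show ?case using d3 by (simp add: th mult.assoc)
    qed
  qed (use b k in simp)
qed

text \<open>Take d = b / ln (1 / C) with \<open>b\<close> slightly above (h - 1) * D. Then exp (- (h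
  - 1) * D / d) = C^\<rho> with \<rho> < 1, and the condition of the Shannon bound becomes C^(1 -
  \<rho>) < ln 2 * d: a power of C against a logarithm.\<close>

lemma Phi_upper_1:
  assumes h: "2 \<le> h" and D: "0 < D" and \<epsilon>: "0 < \<epsilon>"
  shows "eventually (\<lambda>C. Phi TYPE('g::infinite) 1 1 D h C * ln (1 / C) \<le> (real h - 1) * D + \<epsilon>) (at_right 0)"
proof -
  define A where "A = (real h - 1) * D"
  define b where "b = A + \<epsilon>"
  have A: "0 < A" using h D by (simp add: A_def)
  have b: "0 < b" using A \<epsilon> by (simp add: b_def)
  define \<rho> where "\<rho> = A / b"
  have \<rho>: "0 < \<rho>" "0 < 1 - \<rho>" using A b \<epsilon> by (auto simp: \<rho>_def b_def)
  have "eventually (\<lambda>C. C powr (1 - \<rho>) < ln 2 * (b / ln (1 / C))) (at_right 0)"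
    using b \<rho> by real_asymp
  moreover have "eventually (\<lambda>C::real. C < 1) (at_right 0)" by real_asymp
  moreover have "eventually (\<lambda>C::real. 0 < C) (at_right 0)" by (rule eventually_at_right_less)
  ultimately show ?thesis
  proof eventually_elim
    case (elim C)
    define L where "L = ln (1 / C)"
    have L: "0 < L" "ln C = - L" using elim by (auto simp: L_def ln_div)
    define d where "d = b / L"
    have d: "0 < d" using b L by (simp add: d_def)
    have "A / d = \<rho> * L" using b L by (simp add: d_def \<rho>_def)
    then have "exp (- (A / d)) = C powr \<rho>" using elim L by (simp add: powr_def)
    moreover have "C = C powr (1 - \<rho>) * C powr \<rho>" using elim by (simp add: powr_add[symmetric])
    moreover have "C powr (1 - \<rho>) * C powr \<rho> < ln 2 * d * C powr \<rho>"
      using elim by (intro mult_strict_right_mono) (auto simp: d_def L_def)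
    ultimately have C: "C < ln 2 * (d * exp (- ((real h - 1) * D / d)))"
      by (simp add: A_def mult.assoc)
    have "Phi TYPE('g) 1 1 D h C \<le> d"
      by (rule Phi_le) (use h elim D Bh_defect_upper_1[OF h _ D d C] in auto)
    then have "Phi TYPE('g) 1 1 D h C * L \<le> b" using L by (simp add: d_def pos_le_divide_eq)
    then show ?case by (simp add: L_def b_def A_def)
  qed
qed

text \<open>With d = A / ln (1 / C) and N close to C^(-\<sigma>), the entropy is at most d *
  \<sigma> * ln (1 / C) + o(1) = D' + o(1), where D' < D leaves room for the error. The gap is at
  most of order C^e.\<close>

lemma Phi_lower_1:
  assumes h: "2 \<le> h" and D: "0 < D" and \<epsilon>: "0 < \<epsilon>" "\<epsilon> < 1"
  shows "eventually (\<lambda>C. (1 - \<epsilon>) * ((real h - 1) * D) \<le> Phi TYPE('g::infinite) 1 1 D h C * ln (1 / C)) (at_right 0)"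
proof -
  define A where "A = (1 - \<epsilon>) * ((real h - 1) * D)"
  have A: "0 < A" using h D \<epsilon> by (simp add: A_def)
  define D' where "D' = (1 - \<epsilon> / 2) * D"
  have D': "0 < D'" "D' < D" using D \<epsilon> by (auto simp: D'_def)
  \<comment> \<open>Chosen so that d * ln (C^(-\<sigma>)) = D'. As \<open>D'\<close> loses only
    \<epsilon> / 2 where \<open>A\<close> loses \<epsilon>, the exponent e = \<sigma> * (h - 1) = (1
    - \<epsilon>/2) / (1 - \<epsilon>) exceeds 1.\<close>
  define \<sigma> where "\<sigma> = D' / A"
  have \<sigma>: "0 < \<sigma>" using A D' by (simp add: \<sigma>_def)
  define e where "e = \<sigma> * (real h - 1)"
  have e: "0 < e - 1"
  proof -
    have "e = (1 - \<epsilon> / 2) / (1 - \<epsilon>)" using h D \<epsilon> by (simp add: e_def \<sigma>_def A_def D'_def)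
    then show ?thesis using \<epsilon> by simp
  qed
  \<comment> \<open>The power of 2 pays for rounding C^(-\<sigma>) down to \<open>N\<close>; the
    bracket bounds d + h * (- (d * ln m)).\<close>
  define K where "K = 2 ^ (h - 1) * (2 + real h * D' + real h)"
  have K: "0 < K" using D' by (auto simp: K_def intro!: mult_pos_pos add_pos_nonneg)
  have c1: "eventually (\<lambda>C. A / ln (1 / C) < 1 / 2) (at_right 0)" using A by real_asymp
  have "((\<lambda>C. - (A / ln (1 / C) * ln (A / ln (1 / C))) - (1 - A / ln (1 / C)) * ln (1 - A / ln (1 / C))) \<longlongrightarrow> 0) (at_right 0)"
    using A by real_asymp
  then have c2: "eventually (\<lambda>C. - (A / ln (1 / C) * ln (A / ln (1 / C))) - (1 - A / ln (1 / C)) * ln (1 - A / ln (1 / C)) < D - D') (at_right 0)"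
    by (rule order_tendstoD) (use D' in simp)
  have "((\<lambda>C. - (A / ln (1 / C) * ln (A / ln (1 / C)))) \<longlongrightarrow> 0) (at_right 0)"
    using A by real_asymp
  then have c3: "eventually (\<lambda>C. - (A / ln (1 / C) * ln (A / ln (1 / C))) < 1) (at_right 0)"
    by (rule order_tendstoD) simp
  have "((\<lambda>C. K * C powr (e - 1)) \<longlongrightarrow> 0) (at_right 0)"
  proof -
    define e' where "e' = e - 1"
    have "((\<lambda>C. K * C powr e') \<longlongrightarrow> 0) (at_right 0)" using e[folded e'_def] by real_asymp
    then show ?thesis by (simp add: e'_def)
  qed
  then have c4: "eventually (\<lambda>C. K * C powr (e - 1) < 1) (at_right 0)" by (rule order_tendstoD) simp
  have c5: "eventually (\<lambda>C. 2 \<le> C powr (- \<sigma>)) (at_right 0)" using \<sigma> by real_asymp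
  have c6: "eventually (\<lambda>C::real. C < 1) (at_right 0)" by real_asymp
  have c7: "eventually (\<lambda>C::real. 0 < C) (at_right 0)" by (rule eventually_at_right_less)
  from c1 c2 c3 c4 c5 c6 c7 show ?thesis
  proof eventually_elim
    case (elim C)
    define L where "L = ln (1 / C)"
    have L: "0 < L" "ln C = - L" using elim by (auto simp: L_def ln_div)
    define d where "d = A / L"
    have d: "0 < d" "d < 1 / 2" using A L elim(1) by (auto simp: d_def L_def)
    define y where "y = C powr (- \<sigma>)"
    have y: "2 \<le> y" "0 < y" using elim by (auto simp: y_def)
    have dlny: "d * ln y = D'" using elim L A by (simp add: y_def ln_powr d_def \<sigma>_def)
    define N where "N = nat \<lfloor>y\<rfloor>"
    have N: "0 < N" "real N \<le> y" "y / 2 \<le> real N" unfolding N_def using nat_floor_bounds[OF y(1)] by auto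
    define m where "m = d / real N"
    have m: "0 < m" "m \<le> d" using d N by (auto simp: m_def divide_le_eq mult_le_cancel_left1)
    have "ln m = ln d - ln (real N)" using d N by (simp add: m_def ln_div)
    moreover have "ln (real N) \<le> ln y" using N by simp
    ultimately have lnm: "- ln m \<le> ln y - ln d" by simp
    have "d * (- ln m) \<le> d * (ln y - ln d)" using lnm d by (intro mult_left_mono) auto
    then have dlnm: "- (d * ln m) \<le> D' - d * ln d" using dlny by (simp add: algebra_simps)
    have small: "- (d * ln d) - (1 - d) * ln (1 - d) < D - D'" "- (d * ln d) < 1"
      using elim(2,3) by (auto simp: d_def L_def)
    have "d \<le> Phi TYPE('g) 1 1 D h C"
    proof (rule spike_le_Phi_1[OF h N(1)])
      show "0 < d" "d < 1" "d / real N \<le> 1 - d" using d m by (auto simp: m_def[symmetric])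
      show "- ((1 - d) * ln (1 - d)) - d * ln (d / real N) \<le> D"
        unfolding m_def[symmetric] using dlnm small(1) by simp
      have m1: "m < 1" using m d by simp
      have lnm0: "0 \<le> 1 - real h * ln m" using m m1 mult_nonneg_nonpos[of "real h" "ln m"] by simp
      have "real N * m ^ h = real N * m * m ^ (h - 1)"
        using power_minus_mult[of h m] h by (simp add: mult_ac)
      also have "\<dots> = d * (d ^ (h - 1) / real N ^ (h - 1))"
        using N by (simp add: m_def power_divide)
      also have "\<dots> \<le> d * (1 / (y / 2) ^ (h - 1))"
        using d N y by (intro mult_left_mono frac_le power_le_one power_mono) auto
      also have "\<dots> = 2 ^ (h - 1) * d * y powr (1 - real h)"
      proof -
        have "y ^ (h - 1) = y powr (real h - 1)"
          using y h by (simp add: powr_realpow[symmetric] of_nat_diff)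
        moreover have "y powr (1 - real h) = 1 / y powr (real h - 1)"
          using powr_minus_divide[of y "real h - 1"] by simp
        ultimately show ?thesis by (simp add: power_divide)
      qed
      also have "y powr (1 - real h) = C powr e"
        by (simp add: y_def powr_powr e_def algebra_simps)
      finally have Nm: "real N * m ^ h \<le> 2 ^ (h - 1) * d * C powr e" .
      have "real N * m ^ h * (1 - real h * ln m) \<le> 2 ^ (h - 1) * d * C powr e * (1 - real h * ln m)"
        using Nm lnm0 by (rule mult_right_mono)
      also have "\<dots> = 2 ^ (h - 1) * C powr e * (d + real h * (- (d * ln m)))"
        by (simp add: algebra_simps)
      also have "\<dots> \<le> 2 ^ (h - 1) * C powr e * (2 + real h * (D' + 1))"
        using d dlnm small(2) by (intro mult_left_mono add_mono) auto
      also have "\<dots> = K * C powr (e - 1) * C"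
        using elim by (simp add: K_def powr_diff algebra_simps)
      also have "\<dots> \<le> 1 * C" using elim by (intro mult_right_mono) auto
      finally show "real N * (d / real N) ^ h * (1 - real h * ln (d / real N)) \<le> C"
        by (simp add: m_def)
    qed
    then have "A \<le> Phi TYPE('g) 1 1 D h C * L" using L by (simp add: d_def pos_divide_le_eq)
    then show ?case by (simp add: A_def L_def)
  qed
qed

text \<open>The heavy atom \<open>q\<close> satisfies q^\<alpha> = exp (- (\<alpha> - 1) * D), the
  least value that the entropy condition permits. For fixed \<open>C\<close> the mass N * (d / N)^h
  of the light constant multisets tends to 0 as N grows, since h \<ge> 2.\<close>

lemma Phi_lower_greater_1:
  assumes h: "2 \<le> h" and D: "0 < D" and \<alpha>: "1 < \<alpha>" and C: "0 < C"
  shows "1 - exp (- ((\<alpha> - 1) * D / \<alpha>)) \<le> Phi TYPE('g::infinite) \<alpha> \<alpha> D h C"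
proof -
  define q where "q = exp (- ((\<alpha> - 1) * D / \<alpha>))"
  have q: "0 < q" "q < 1" using D \<alpha> by (auto simp: q_def)
  define d where "d = 1 - q"
  have d: "0 < d" "d < 1" using q by (auto simp: d_def)
  have lim0: "(\<lambda>N. d / real N) \<longlonglongrightarrow> 0" by real_asymp
  then have 1: "eventually (\<lambda>N. d / real N < q) sequentially" by (rule order_tendstoD) (rule q)
  have "(\<lambda>N. d * (d / real N) ^ (h - 1)) \<longlonglongrightarrow> d * 0 ^ (h - 1)"
    by (intro tendsto_intros lim0)
  then have lim: "(\<lambda>N. d * (d / real N) ^ (h - 1)) \<longlonglongrightarrow> 0" using h by (simp add: power_0_left)
  have "eventually (\<lambda>N. d * (d / real N) ^ (h - 1) = real N * (d / real N) ^ h) sequentially"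
    using eventually_gt_at_top[of 0]
  proof eventually_elim
    case (elim N)
    then show ?case using power_minus_mult[of h "d / real N"] h by (simp add: field_simps)
  qed
  from Lim_transform_eventually[OF lim this]
  have "(\<lambda>N. real N * (d / real N) ^ h) \<longlonglongrightarrow> 0" .
  then have "(\<lambda>N. ((q ^ h + real N * (d / real N) ^ h) powr \<alpha> - (q ^ h) powr \<alpha>) / (q ^ h) powr \<alpha>)
      \<longlonglongrightarrow> ((q ^ h + 0) powr \<alpha> - (q ^ h) powr \<alpha>) / (q ^ h) powr \<alpha>"
    using q by (intro tendsto_intros) auto
  then have 2: "eventually (\<lambda>N. ((q ^ h + real N * (d / real N) ^ h) powr \<alpha> - (q ^ h) powr \<alpha>) / (q ^ h) powr \<alpha>
      < (\<alpha> - 1) * C) sequentially"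
    by (rule order_tendstoD) (use C \<alpha> in simp)
  have "eventually (\<lambda>N::nat. d \<le> Phi TYPE('g) \<alpha> \<alpha> D h C) sequentially"
    using 1 2 eventually_gt_at_top[of 0]
  proof eventually_elim
    case (elim N)
    have qd: "1 - d = q" by (simp add: d_def)
    show ?case
    proof (rule spike_le_Phi_greater_1[OF h \<alpha> elim(3) d])
      show "exp (- ((\<alpha> - 1) * D)) \<le> (1 - d) powr \<alpha>" using \<alpha> by (simp add: qd) (simp add: q_def powr_def)
    qed (use elim qd in auto)
  qed
  then show ?thesis by (simp add: d_def q_def)
qed

lemma Phi_upper_greater_1:
  assumes h: "2 \<le> h" and D: "0 < D" and \<alpha>: "1 < \<alpha>"
  obtains f where "(f \<longlongrightarrow> 1 - exp (- ((\<alpha> - 1) * D / \<alpha>))) (at_right 0)"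
    "eventually (\<lambda>C. Phi TYPE('g::infinite) \<alpha> \<alpha> D h C \<le> f C) (at_right 0)"
proof -
  define E where "E = exp (- ((\<alpha> - 1) * D))"
  define t where "t C = ((exp ((\<alpha> - 1) * C) - 1) / (2 powr (\<alpha> - 1) - 1)) powr (1 / (real h * \<alpha>))" for C
  define f where "f C = 1 - (E - t C powr (\<alpha> - 1)) powr (1 / \<alpha>)" for C
  have 2: "1 < (2::real) powr (\<alpha> - 1)"
    using powr_less_mono[of 0 "\<alpha> - 1" "2::real"] \<alpha> by simp
  define r where "r C = (exp ((\<alpha> - 1) * C) - 1) / (2 powr (\<alpha> - 1) - 1)" for C
  have "((\<lambda>C. (exp ((\<alpha> - 1) * C) - 1) / (2 powr (\<alpha> - 1) - 1)) \<longlongrightarrow> (exp ((\<alpha> - 1) * 0) - 1) / (2 powr (\<alpha> - 1) - 1)) (at_right 0)"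
    using 2 by (intro tendsto_intros) auto
  then have r0: "(r \<longlongrightarrow> 0) (at_right 0)" by (simp add: r_def[abs_def])
  have rnn: "eventually (\<lambda>C. 0 \<le> r C) (at_right 0)"
    using eventually_at_right_less[of "0::real"] by eventually_elim (use 2 \<alpha> in \<open>auto simp: r_def intro!: divide_nonneg_pos\<close>)
  have "((\<lambda>C. r C powr (1 / (real h * \<alpha>))) \<longlongrightarrow> 0 powr (1 / (real h * \<alpha>))) (at_right 0)"
    using r0 tendsto_const rnn h \<alpha> by (intro tendsto_powr2) auto
  then have t0: "(t \<longlongrightarrow> 0) (at_right 0)" by (simp add: t_def[abs_def] r_def)
  have tnn: "0 \<le> t C" for C by (simp add: t_def)
  have "((\<lambda>C. t C powr (\<alpha> - 1)) \<longlongrightarrow> 0 powr (\<alpha> - 1)) (at_right 0)"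
    using t0 \<alpha> tnn by (intro tendsto_powr2 tendsto_const) auto
  then have t1: "((\<lambda>C. t C powr (\<alpha> - 1)) \<longlongrightarrow> 0) (at_right 0)" by simp
  have "(f \<longlongrightarrow> 1 - (E - 0) powr (1 / \<alpha>)) (at_right 0)"
    unfolding f_def[abs_def] using t1 by (intro tendsto_intros) (auto simp: E_def)
  then have f: "(f \<longlongrightarrow> 1 - exp (- ((\<alpha> - 1) * D / \<alpha>))) (at_right 0)"
    by (simp add: E_def powr_def)
  have "eventually (\<lambda>C. t C powr (\<alpha> - 1) < E) (at_right 0)"
    using t1 by (rule order_tendstoD) (simp add: E_def)
  then have "eventually (\<lambda>C. Phi TYPE('g) \<alpha> \<alpha> D h C \<le> f C) (at_right 0)"
    using eventually_at_right_less[of "0::real"]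
  proof eventually_elim
    case (elim C)
    show ?case
    proof (rule Phi_le)
      fix G :: "'g monoid" and X assume "admissible \<alpha> \<alpha> D h C G X"
      from Bh_defect_upper_greater_1[OF h this \<alpha>] elim show "Bh_defect h G X \<le> f C"
        by (simp add: f_def t_def E_def)
    qed (use h elim D in auto)
  qed
  with f show thesis by (rule that)
qed

theorem corollary1p4:
  fixes h :: nat and D :: real
  assumes "h \<ge> 2" and "D > 0"
  shows
    "(\<forall>\<alpha>::real. 0 < \<alpha> \<and> \<alpha> < 1 \<longrightarrow>
        (\<exists>c1 c2 C0. 0 < c1 \<and> 0 < c2 \<and> 0 < C0 \<and>
          (\<forall>C. 0 < C \<and> C < C0 \<longrightarrow>
             c1 * C powr theta h \<alpha> \<le> Phi TYPE('g::infinite) \<alpha> \<alpha> D h C \<and>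
             Phi TYPE('g) \<alpha> \<alpha> D h C \<le> c2 * C powr theta h \<alpha>)) \<and>
        (theta h \<alpha> = 1 / (real h * \<alpha>) \<longleftrightarrow> \<alpha> \<le> 1 / real h) \<and>
        (theta h \<alpha> = (1 - \<alpha>) / ((real h - 1) * \<alpha>) \<longleftrightarrow> 1 / real h \<le> \<alpha>)) \<and>
     ((\<lambda>C. Phi TYPE('g) 1 1 D h C * ln (1 / C)) \<longlongrightarrow> (real h - 1) * D) (at_right 0) \<and>
     (\<forall>\<alpha>::real. 1 < \<alpha> \<longrightarrow>
        ((\<lambda>C. Phi TYPE('g) \<alpha> \<alpha> D h C) \<longlongrightarrow> 1 - exp (- ((\<alpha> - 1) * D / \<alpha>))) (at_right 0) \<and>
        1 - exp (- ((\<alpha> - 1) * D / \<alpha>)) > 0)"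
proof (intro conjI allI impI; (elim conjE)?)
  fix \<alpha> :: real
  assume \<alpha>: "0 < \<alpha>" "\<alpha> < 1"
  obtain c1 where c1: "0 < c1"
    and "eventually (\<lambda>C. c1 * C powr theta h \<alpha> \<le> Phi TYPE('g) \<alpha> \<alpha> D h C) (at_right 0)"
    using Phi_lower_less_1[where 'g = 'g, OF assms \<alpha>] by blast
  then obtain C1 where C1: "0 < C1"
    "\<And>C. 0 < C \<Longrightarrow> C < C1 \<Longrightarrow> c1 * C powr theta h \<alpha> \<le> Phi TYPE('g) \<alpha> \<alpha> D h C"
    by (auto simp: eventually_at_right_field)
  obtain c2 where c2: "0 < c2" "\<And>C (G :: 'g monoid) X. 0 < C \<Longrightarrow> C \<le> 1 \<Longrightarrow>
      admissible \<alpha> \<alpha> D h C G X \<Longrightarrow> Bh_defect h G X \<le> c2 * C powr theta h \<alpha>"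
    using Bh_defect_upper_less_1[where 'g = 'g, OF assms(1) \<alpha>] by blast
  have "Phi TYPE('g) \<alpha> \<alpha> D h C \<le> c2 * C powr theta h \<alpha>" if "0 < C" "C < 1" for C
    by (rule Phi_le) (use assms that c2(2) in auto)
  then show "\<exists>c1 c2 C0. 0 < c1 \<and> 0 < c2 \<and> 0 < C0 \<and>
          (\<forall>C. 0 < C \<and> C < C0 \<longrightarrow>
             c1 * C powr theta h \<alpha> \<le> Phi TYPE('g::infinite) \<alpha> \<alpha> D h C \<and>
             Phi TYPE('g) \<alpha> \<alpha> D h C \<le> c2 * C powr theta h \<alpha>)"
    using c1 c2(1) C1 by (intro exI[of _ c1] exI[of _ c2] exI[of _ "min C1 1"]) auto
  show "theta h \<alpha> = 1 / (real h * \<alpha>) \<longleftrightarrow> \<alpha> \<le> 1 / real h"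
    using theta_branch_iff(1)[OF assms(1) \<alpha>(1)] by (auto simp: theta_def min_def)
  show "theta h \<alpha> = (1 - \<alpha>) / ((real h - 1) * \<alpha>) \<longleftrightarrow> 1 / real h \<le> \<alpha>"
    using theta_branch_iff(2)[OF assms(1) \<alpha>(1)] by (auto simp: theta_def min_def)
next
  define l where "l = (real h - 1) * D"
  have l: "0 < l" using assms by (simp add: l_def)
  have "((\<lambda>C. Phi TYPE('g) 1 1 D h C * ln (1 / C)) \<longlongrightarrow> l) (at_right 0)"
  proof (rule order_tendstoI)
    fix a assume a: "l < a"
    then have "0 < (a - l) / 2" by simp
    from Phi_upper_1[where 'g = 'g, OF assms this]
    show "\<forall>\<^sub>F C in at_right 0. Phi TYPE('g) 1 1 D h C * ln (1 / C) < a"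
      unfolding l_def[symmetric]
    proof eventually_elim
      case (elim C)
      moreover have "l + (a - l) / 2 < a" using a by (simp add: field_simps)
      ultimately show ?case by (rule le_less_trans)
    qed
  next
    fix a assume a: "a < l"
    \<comment> \<open>The second entry gives \<epsilon> * l \<le> (l - a) / 2, so (1 - \<epsilon>) *
      l lies above \<open>a\<close>; the cap 1 / 2 keeps \<epsilon> below 1 when \<open>a\<close> is
      very negative.\<close>
    define \<epsilon> where "\<epsilon> = min (1 / 2) ((l - a) / (2 * l))"
    have \<epsilon>: "0 < \<epsilon>" "\<epsilon> < 1" using a l by (auto simp: \<epsilon>_def)
    have "\<epsilon> * l \<le> (l - a) / (2 * l) * l" using l by (intro mult_right_mono) (auto simp: \<epsilon>_def)
    also have "\<dots> = (l - a) / 2" using l by simp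
    finally have "a < (1 - \<epsilon>) * l" using a by (simp add: algebra_simps)
    with Phi_lower_1[where 'g = 'g, OF assms \<epsilon>]
    show "\<forall>\<^sub>F C in at_right 0. a < Phi TYPE('g) 1 1 D h C * ln (1 / C)"
      unfolding l_def[symmetric] by (auto elim!: eventually_mono)
  qed
  then show "((\<lambda>C. Phi TYPE('g) 1 1 D h C * ln (1 / C)) \<longlongrightarrow> (real h - 1) * D) (at_right 0)"
    unfolding l_def .
next
  fix \<alpha> :: real
  assume \<alpha>: "1 < \<alpha>"
  obtain f where f: "(f \<longlongrightarrow> 1 - exp (- ((\<alpha> - 1) * D / \<alpha>))) (at_right 0)"
    "eventually (\<lambda>C. Phi TYPE('g) \<alpha> \<alpha> D h C \<le> f C) (at_right 0)"
    using Phi_upper_greater_1[where 'g = 'g, OF assms \<alpha>] by blast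
  have "eventually (\<lambda>C. 1 - exp (- ((\<alpha> - 1) * D / \<alpha>)) \<le> Phi TYPE('g) \<alpha> \<alpha> D h C) (at_right 0)"
    using eventually_at_right_less[of "0::real"] by eventually_elim (rule Phi_lower_greater_1[OF assms \<alpha>])
  then show "((\<lambda>C. Phi TYPE('g) \<alpha> \<alpha> D h C) \<longlongrightarrow> 1 - exp (- ((\<alpha> - 1) * D / \<alpha>))) (at_right 0)"
    by (rule tendsto_sandwich[OF _ f(2) tendsto_const f(1)])
  show "1 - exp (- ((\<alpha> - 1) * D / \<alpha>)) > 0" using assms \<alpha> by simp
qed

end
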